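(* Let $K$ be a field of characteristic $0$ or of characteristic coprime to $n!$, and let $R_n=K[x_1,\dots,x_{n-1}]/(x_1,\dots,x_{n-1})^2$. Then the dimension of $G(R_n/K)$ over $K$ is strictly greater than $n!$ for $n>3$.
   Context: All rings are commutative with unity. Note that $R_n$ has dimension $n$ over $K$. Let $A$ be a $K$-algebra of dimension $n$. For $a\in A$ let $P_a(x)=x^n-s_1(a)x^{n-1}+s_2(a)x^{n-2}-\cdots+(-1)^n s_n(a)$ be the characteristic polynomial of the $K$-linear map $A\to A$ given by multiplication by $a$; this defines $s_j(a)\in K$ for $1\le j\le n$. All tensor powers are over $K$. For $a\in A$ and $1\le i\le n$ let $a^{(i)}=1\otimes\cdots\otimes a\otimes\cdots\otimes 1\in A^{\otimes n}$, with $a$ in the $i$-th tensor factor. Let $I(A,K)\subset A^{\otimes n}$ be the ideal generated by all elements $$s_j(a)-\sum_{1\le i_1<\cdots<i_j\le n}a^{(i_1)}a^{(i_2)}\cdots a^{(i_j)},\qquad a\in A,\ 1\le j\le n.$$ The $S_n$-closure of $A$ over $K$ is the $K$-algebra $G(A/K)=A^{\otimes n}/I(A,K)$. *)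

theory Defs
  imports
    "HOL-Algebra.Ideal_Product"
    "HOL-Algebra.QuotRing"
    "HOL-Algebra.Product_Groups"
    "HOL-Library.Poly_Mapping"
    "Jordan_Normal_Form.VS_Connect"
    "Jordan_Normal_Form.Char_Poly"
begin

text \<open>
  The base field is a type \<open>'k\<close> of class \<^class>\<open>field\<close>, viewed as a ring record through
  \<^const>\<open>class_ring\<close>; a \<open>'k\<close>-algebra is a record \<open>A\<close> with \<open>algebra class_ring A\<close>.
\<close>

definition quotient_algebra ::
    "('k, 'a, 'm) module_scheme \<Rightarrow> 'a set \<Rightarrow> ('k, 'a set) module" where
  "quotient_algebra A I =
     \<lparr>carrier = carrier (A Quot I), monoid.mult = monoid.mult (A Quot I), one = monoid.one (A Quot I),
      zero = ring.zero (A Quot I), add = ring.add (A Quot I),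
      module.smult = (\<lambda>c X. \<Union>x\<in>X. I +>\<^bsub>A\<^esub> (c \<odot>\<^bsub>A\<^esub> x))\<rparr>"


subsection \<open>The algebra \<open>R\<^sub>n\<close>\<close>

text \<open>
  Elements of \<open>(nat \<Rightarrow>\<^sub>0 nat) \<Rightarrow>\<^sub>0 'k\<close> are polynomials in the variables
  \<open>x\<^sub>0, x\<^sub>1, x\<^sub>2, \<dots>\<close>: an exponent vector is a finitely supported map \<open>nat \<Rightarrow>\<^sub>0 nat\<close>, and
  multiplication of polynomial mappings is convolution.
\<close>

definition polynomial_algebra ::
    "nat set \<Rightarrow> ('k::field, (nat \<Rightarrow>\<^sub>0 nat) \<Rightarrow>\<^sub>0 'k) module" where
  "polynomial_algebra V =
     \<lparr>carrier = {p. \<forall>m\<in>Poly_Mapping.keys p. Poly_Mapping.keys m \<subseteq> V},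
      monoid.mult = (*), one = 1, zero = 0, add = (+),
      module.smult = (\<lambda>c. Poly_Mapping.map ((*) c))\<rparr>"

definition variable :: "nat \<Rightarrow> (nat \<Rightarrow>\<^sub>0 nat) \<Rightarrow>\<^sub>0 'k::field" where
  "variable i = Poly_Mapping.single (Poly_Mapping.single i 1) 1"

definition R_alg :: "nat \<Rightarrow> ('k::field, ((nat \<Rightarrow>\<^sub>0 nat) \<Rightarrow>\<^sub>0 'k) set) module" where
  "R_alg n =
     (let P = polynomial_algebra {1..n - 1};
          m = Idl\<^bsub>P\<^esub> (variable ` {1..n - 1})
      in quotient_algebra P (m \<cdot>\<^bsub>P\<^esub> m))"


subsection \<open>The coefficients \<open>s\<^sub>j(a)\<close>\<close>

text \<open>\<open>M\<close> is the matrix of multiplication by \<open>a\<close> in the ordered basis \<open>bs\<close>.\<close>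

definition mult_matrix ::
    "('k::field, 'a, 'm) module_scheme \<Rightarrow> 'a list \<Rightarrow> 'a \<Rightarrow> 'k mat \<Rightarrow> bool" where
  "mult_matrix A bs a M \<longleftrightarrow>
     M \<in> carrier_mat (length bs) (length bs) \<and>
     (\<forall>j<length bs. a \<otimes>\<^bsub>A\<^esub> bs ! j = (\<Oplus>\<^bsub>A\<^esub>i\<in>{..<length bs}. (M $$ (i, j)) \<odot>\<^bsub>A\<^esub> (bs ! i)))"

text \<open>
  The characteristic polynomial does not depend on the basis, so the description is unique for
  finite-dimensional \<open>A\<close>; \<open>s\<^sub>j(a)\<close> is \<open>(-1)\<^sup>j\<close> times its coefficient at \<open>n - j\<close>.
\<close>

definition mult_char_poly :: "('k::field, 'a, 'm) module_scheme \<Rightarrow> 'a \<Rightarrow> 'k poly" where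
  "mult_char_poly A a =
     (THE p. \<exists>bs M. distinct bs \<and> vectorspace.basis class_ring A (set bs) \<and>
                    mult_matrix A bs a M \<and> p = char_poly M)"

definition s_coeff :: "('k::field, 'a, 'm) module_scheme \<Rightarrow> nat \<Rightarrow> 'a \<Rightarrow> 'k" where
  "s_coeff A j a =
     (- 1) ^ j * Polynomial.coeff (mult_char_poly A a) (vectorspace.dim class_ring A - j)"


subsection \<open>Tensor powers\<close>

text \<open>
  The monoid algebra of \<open>M\<close>: the free \<open>'k\<close>-module on the carrier of \<open>M\<close>, with multiplication
  extended bilinearly from \<open>M\<close>.
\<close>

definition monoid_algebra ::
    "('b, 'c) monoid_scheme \<Rightarrow> ('k::field, 'b \<Rightarrow>\<^sub>0 'k) module" where
  "monoid_algebra M =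
     \<lparr>carrier = {p. Poly_Mapping.keys p \<subseteq> carrier M},
      monoid.mult = (\<lambda>p q. \<Sum>u\<in>Poly_Mapping.keys p. \<Sum>v\<in>Poly_Mapping.keys q.
                Poly_Mapping.single (u \<otimes>\<^bsub>M\<^esub> v) (Poly_Mapping.lookup p u * Poly_Mapping.lookup q v)),
      one = Poly_Mapping.single \<one>\<^bsub>M\<^esub> 1, zero = 0, add = (+),
      module.smult = (\<lambda>c. Poly_Mapping.map ((*) c))\<rparr>"

definition multilinear_relations ::
    "nat \<Rightarrow> ('k::field, 'a, 'm) module_scheme \<Rightarrow> ((nat \<Rightarrow> 'a) \<Rightarrow>\<^sub>0 'k) set" where
  "multilinear_relations n A =
     {Poly_Mapping.single (f(i := a \<oplus>\<^bsub>A\<^esub> b)) 1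
        - Poly_Mapping.single (f(i := a)) 1 - Poly_Mapping.single (f(i := b)) 1 | f i a b.
        f \<in> {1..n} \<rightarrow>\<^sub>E carrier A \<and> i \<in> {1..n} \<and> a \<in> carrier A \<and> b \<in> carrier A}
   \<union> {Poly_Mapping.single (f(i := c \<odot>\<^bsub>A\<^esub> a)) 1 - Poly_Mapping.single (f(i := a)) c | f i c a.
        f \<in> {1..n} \<rightarrow>\<^sub>E carrier A \<and> i \<in> {1..n} \<and> a \<in> carrier A}"

text \<open>
  The \<open>n\<close>-fold tensor power as the free module on \<open>A\<^sup>n\<close> modulo the multilinearity relations, with
  componentwise multiplication of pure tensors. The product of a basis element and a relation
  is again a relation, so the submodule spanned by the relations is the ideal they generate.
\<close>

definition tensor_power ::
    "nat \<Rightarrow> ('k::field, 'a, 'm) module_scheme \<Rightarrow> ('k, ((nat \<Rightarrow> 'a) \<Rightarrow>\<^sub>0 'k) set) module" where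
  "tensor_power n A =
     (let F = monoid_algebra (product_group {1..n} (\<lambda>_. A))
      in quotient_algebra F (Idl\<^bsub>F\<^esub> (multilinear_relations n A)))"

definition pure_tensor ::
    "nat \<Rightarrow> ('k::field, 'a, 'm) module_scheme \<Rightarrow> (nat \<Rightarrow> 'a) \<Rightarrow> ((nat \<Rightarrow> 'a) \<Rightarrow>\<^sub>0 'k) set" where
  "pure_tensor n A f =
     (let F = monoid_algebra (product_group {1..n} (\<lambda>_. A))
      in (Idl\<^bsub>F\<^esub> (multilinear_relations n A)) +>\<^bsub>F\<^esub> Poly_Mapping.single (restrict f {1..n}) 1)"

text \<open>\<open>tensor_factor n A i a\<close> is \<open>a\<^sup>(\<^sup>i\<^sup>)\<close>.\<close>

definition tensor_factor ::
    "nat \<Rightarrow> ('k::field, 'a, 'm) module_scheme \<Rightarrow> nat \<Rightarrow> 'a \<Rightarrow> ((nat \<Rightarrow> 'a) \<Rightarrow>\<^sub>0 'k) set" where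
  "tensor_factor n A i a = pure_tensor n A (\<lambda>j. if j = i then a else \<one>\<^bsub>A\<^esub>)"


subsection \<open>The \<open>S\<^sub>n\<close>-closure\<close>

text \<open>Index tuples \<open>i\<^sub>1 < \<dots> < i\<^sub>j\<close> are encoded as \<open>j\<close>-element subsets of \<open>{1..n}\<close>.\<close>

definition closure_ideal ::
    "('k::field, 'a, 'm) module_scheme \<Rightarrow> ((nat \<Rightarrow> 'a) \<Rightarrow>\<^sub>0 'k) set set" where
  "closure_ideal A =
     (let n = vectorspace.dim class_ring A; T = tensor_power n A
      in Idl\<^bsub>T\<^esub> {(s_coeff A j a \<odot>\<^bsub>T\<^esub> \<one>\<^bsub>T\<^esub>) \<ominus>\<^bsub>T\<^esub>
                  (\<Oplus>\<^bsub>T\<^esub>S\<in>{S. S \<subseteq> {1..n} \<and> card S = j}. \<Otimes>\<^bsub>T\<^esub>i\<in>S. tensor_factor n A i a) | a j.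
                a \<in> carrier A \<and> j \<in> {1..n}})"

definition Sn_closure ::
    "('k::field, 'a, 'm) module_scheme \<Rightarrow> ('k, ((nat \<Rightarrow> 'a) \<Rightarrow>\<^sub>0 'k) set set) module" where
  "Sn_closure A =
     quotient_algebra (tensor_power (vectorspace.dim class_ring A) A) (closure_ideal A)"

end

theory Submission
  imports Defs "HOL-Combinatorics.Multiset_Permutations" "HOL-Library.List_Lexorder"
begin

text \<open>Write \<open>e\<^sub>0 = 1, e\<^sub>1, \<dots>\<close> for the basis \<open>1, x\<^sub>1, \<dots>, x\<^sub>n\<^sub>-\<^sub>1\<close> of \<open>R\<^sub>n\<close> and \<open>a\<^sub>0\<close> for the constant
term of \<open>a\<close>. Products of two variables vanish, so multiplication by \<open>a\<close> is triangular with
diagonal \<open>a\<^sub>0\<close>, its characteristic polynomial is \<open>(x - a\<^sub>0)\<^sup>n\<close>, and \<open>s\<^sub>j(a)\<close> is \<open>(-1)\<^sup>j\<close> times the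
coefficient of \<open>z\<^sup>j\<close> in \<open>(1 - a\<^sub>0 z)\<^sup>n\<close>. A lower bound for the dimension of the closure
is obtained from linear functionals on the tensor power that vanish on the defining ideal.

The functionals. Let \<open>w\<close> be a word of length \<open>n\<close> in the letters \<open>0, \<dots>, n-1\<close> whose positions are
divided into columns such that the letters in each column strictly decrease and end with \<open>0\<close>. Let
\<open>\<phi>\<^sub>w\<close> send a pure tensor \<open>f\<close> to the product, over the columns, of the determinants of the matrices
with entries (coordinate number \<open>w\<^sub>q\<close> of \<open>f\<^sub>p\<close>), where \<open>p\<close> and \<open>q\<close> range over the column. Replacing
every \<open>f\<^sub>p\<close> by \<open>(1 - z a) f\<^sub>p\<close> multiplies such a matrix by \<open>1 - a\<^sub>0 z\<close> and then adds multiples of the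
column for the letter \<open>0\<close> to the others; since every column contains the letter \<open>0\<close>, this is a
multiplication by a triangular matrix with diagonal \<open>1 - a\<^sub>0 z\<close>. Hence \<open>\<phi>\<^sub>w\<close> is multiplied by
\<open>(1 - a\<^sub>0 z)\<^sup>n\<close>, and comparing the coefficients of \<open>z\<^sup>j\<close> shows that \<open>\<phi>\<^sub>w\<close> vanishes on the multiples of
the generators of the ideal (\<open>sum_det_chain_matrix_subsets\<close>,
\<open>functional_vanishes_on_closure_relations\<close>).

Independence. On the pure tensor \<open>e\<^sub>v\<^sub>1 \<otimes> \<dots> \<otimes> e\<^sub>v\<^sub>n\<close> of a word \<open>v\<close> the functional \<open>\<phi>\<^sub>w\<close> is nonzero only if
\<open>v\<close> arises from \<open>w\<close> by permuting letters inside columns, hence only if \<open>v \<le> w\<close> lexicographically, and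
its value for \<open>v = w\<close> is \<open>1\<close>. By triangularity the tensors of all such words are
linearly independent in the closure (\<open>det_chain_matrix_lex\<close>, \<open>card_le_dim_if_triangular\<close>).

Counting. Insert the letters of a permutation of \<open>1, \<dots>, n\<close> one after the other into a row, where a
new letter expels the largest letter of the row that is smaller than it, if there is one. This is
the first row of Schensted's insertion. Recording the expelled letters, with \<open>0\<close> when nothing is
expelled, and reading this record backwards yields a word of the above kind: its columns are the places of the row. The
permutation can be recovered from the word, so there are at least \<open>n!\<close> words
(\<open>bumped_columns\<close>, \<open>bumped_inj_on_permutations\<close>). For \<open>n > 3\<close> the word \<open>1 1 0 \<dots> 0\<close> is also of this kind,
and it does not come from a permutation because a letter is expelled at most once.
This gives the strict inequality. The closure is finite-dimensional because the tensors of basis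
elements span the tensor power.\<close>

section \<open>Words obtained from permutations\<close>

text \<open>The list \<open>cs\<close> names the column of every position. Strict decrease makes every column of \<open>w\<close> the
lexicographically largest arrangement of its letters, and the letter \<open>0\<close> in every column makes
the column determinants compatible with the relations of the closure.\<close>

definition chain_word :: "nat list \<Rightarrow> nat list \<Rightarrow> bool" where
  "chain_word cs w \<longleftrightarrow> length cs = length w \<and>
     (\<forall>p q. p < q \<and> q < length w \<and> cs ! p = cs ! q \<longrightarrow> w ! q < w ! p) \<and>
     (\<forall>q<length w. \<exists>p<length w. cs ! p = cs ! q \<and> w ! p = 0)"

definition chain_words :: "nat \<Rightarrow> nat list set" where
  "chain_words n = {w. length w = n \<and> set w \<subseteq> {..<n} \<and> (\<exists>cs. chain_word cs w)}"

text \<open>The value \<open>0\<close> stands for the insertion of \<open>x\<close> into \<open>R\<close> without an expelled letter. Since \<open>0\<close> is never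
a letter of a row, removing it from a row, as \<open>row\<close> below does, has no effect. A row is a set
because its order is forced.\<close>

definition bump :: "nat \<Rightarrow> nat set \<Rightarrow> nat" where
  "bump x R = Max {y \<in> insert 0 R. y < x}"

text \<open>The head of the list is the letter that is inserted last, so that insertion is structural
recursion. Words are therefore read from the last insertion to the first one, which turns the
increase of the expelled letters over time into the decrease required by \<open>chain_word\<close>.\<close>

fun row :: "nat list \<Rightarrow> nat set" where
  "row [] = {}"
| "row (x # xs) = insert x (row xs) - {bump x (row xs)}"

fun bumped :: "nat list \<Rightarrow> nat list" where
  "bumped [] = []"
| "bumped (x # xs) = bump x (row xs) # bumped xs"

lemma bump_mem:
  assumes "0 < x"
  shows "bump x R \<in> insert 0 R" "bump x R < x"
    and "\<And>y. y \<in> R \<Longrightarrow> y < x \<Longrightarrow> y \<le> bump x R"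
proof -
  have f: "finite {y \<in> insert 0 R. y < x}" by simp
  have "bump x R \<in> {y \<in> insert 0 R. y < x}"
    unfolding bump_def using assms by (intro Max_in f) auto
  then show "bump x R \<in> insert 0 R" "bump x R < x" by auto
  show "\<And>y. y \<in> R \<Longrightarrow> y < x \<Longrightarrow> y \<le> bump x R"
    unfolding bump_def by (rule Max_ge[OF f]) auto
qed

lemma length_bumped [simp]: "length (bumped xs) = length xs"
  by (induction xs) auto

lemma row_subset: "row xs \<subseteq> set xs"
  by (induction xs) auto

lemma set_bumped_subset:
  "0 \<notin> set xs \<Longrightarrow> set (bumped xs) \<subseteq> insert 0 (set xs)"
proof (induction xs)
  case (Cons x xs)
  then show ?case using bump_mem(1)[of x "row xs"] row_subset[of xs] by auto
qed simp

text \<open>The final row needs no separate record: it consists of the letters that are not expelled. This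
is why the word alone determines the permutation.\<close>

lemma row_eq_never_bumped:
  "distinct xs \<Longrightarrow> 0 \<notin> set xs \<Longrightarrow> row xs = set xs - set (bumped xs)"
proof (induction xs)
  case (Cons x xs)
  then show ?case using set_bumped_subset[of xs] by auto
qed simp

lemma bumped_lt:
  "0 \<notin> set xs \<Longrightarrow> (\<And>x. x \<in> set xs \<Longrightarrow> x \<le> n) \<Longrightarrow> y \<in> set (bumped xs) \<Longrightarrow> y < n"
proof (induction xs)
  case (Cons x xs)
  then show ?case using bump_mem(2)[of x "row xs"]
    by (auto) (metis gr0I less_le_trans)
qed simp

text \<open>One insertion step can be undone: no letter of the row lies strictly between the expelled letter and
the inserted letter \<open>x\<close>, so \<open>x\<close> is the successor of the expelled letter in the new row.\<close>

lemma least_above_bump: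
  assumes "x \<notin> R" "0 < x" "0 \<notin> R"
  shows "x = (LEAST z. z \<in> insert x R - {bump x R} \<and> bump x R < z)"
proof (rule sym, rule Least_equality)
  show "x \<in> insert x R - {bump x R} \<and> bump x R < x"
    using bump_mem(2)[OF assms(2), of R] by auto
next
  fix z assume z: "z \<in> insert x R - {bump x R} \<and> bump x R < z"
  show "x \<le> z"
  proof (rule ccontr)
    assume "\<not> x \<le> z"
    then show False using z bump_mem(3)[OF assms(2), of z R] by auto
  qed
qed

lemma row_bumped_inj:
  assumes "distinct xs" "distinct ys" "0 \<notin> set xs" "0 \<notin> set ys"
    and "row xs = row ys" "bumped xs = bumped ys"
  shows "xs = ys"
  using assms
proof (induction xs arbitrary: ys)
  case Nil
  then show ?case by (cases ys) auto
next
  case (Cons x xs)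
  obtain y ys' where ys: "ys = y # ys'"
    using Cons.prems(6) by (cases ys) auto
  have b: "bump x (row xs) = bump y (row ys')" and bs: "bumped xs = bumped ys'"
    using Cons.prems(6) ys by auto
  have r: "insert x (row xs) - {bump x (row xs)} = insert y (row ys') - {bump x (row xs)}"
    using Cons.prems(5) ys b by simp
  have nx: "x \<notin> row xs" "0 \<notin> row xs" "0 < x" "y \<notin> row ys'" "0 \<notin> row ys'" "0 < y"
    using Cons.prems(1-4) ys row_subset[of xs] row_subset[of ys'] by auto
  have "x = (LEAST z. z \<in> insert x (row xs) - {bump x (row xs)} \<and> bump x (row xs) < z)"
    by (rule least_above_bump[OF nx(1,3,2)])
  also have "\<dots> = (LEAST z. z \<in> insert y (row ys') - {bump y (row ys')} \<and> bump y (row ys') < z)"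
    unfolding r unfolding b ..
  also have "\<dots> = y"
    by (rule least_above_bump[OF nx(4,6,5), symmetric])
  finally have xy: "x = y" .
  \<comment> \<open>The old row is regained by taking out the inserted letter and putting back the expelled one.\<close>
  have inv: "(insert z R - {bump z R}) - {z} \<union> ({bump z R} - {0}) = R"
    if "z \<notin> R" "0 \<notin> R" "0 < z" for z R
    using bump_mem(1,2)[OF that(3), of R] that by (cases "bump z R = 0") auto
  have "row xs = (insert x (row xs) - {bump x (row xs)}) - {x} \<union> ({bump x (row xs)} - {0})"
    by (rule inv[OF nx(1-3), symmetric])
  also have "\<dots> = (insert y (row ys') - {bump y (row ys')}) - {y} \<union> ({bump y (row ys')} - {0})"
    unfolding r unfolding b unfolding xy ..
  also have "\<dots> = row ys'"
    by (rule inv[OF nx(4-6)])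
  finally have rows: "row xs = row ys'" .
  have "distinct xs" "distinct ys'" "0 \<notin> set xs" "0 \<notin> set ys'"
    using Cons.prems(1-4) ys by auto
  then have "xs = ys'" using rows bs by (rule Cons.IH)
  then show ?case using xy ys by simp
qed

lemma bumped_inj_on_permutations:
  "inj_on bumped (permutations_of_set {1..n})"
proof (rule inj_onI)
  fix xs ys assume *: "xs \<in> permutations_of_set {1..n}" "ys \<in> permutations_of_set {1..n}"
    and b: "bumped xs = bumped ys"
  have d: "distinct xs" "distinct ys" "set xs = {1..n}" "set ys = {1..n}"
    using * by (auto simp: permutations_of_set_def)
  then have nz: "0 \<notin> set xs" "0 \<notin> set ys" by auto
  have "row xs = row ys" using row_eq_never_bumped[OF d(1) nz(1)] row_eq_never_bumped[OF d(2) nz(2)] b d by simp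
  with d(1,2) nz show "xs = ys" using b by (rule row_bumped_inj)
qed

text \<open>The map \<open>h\<close> gives the place of every letter of the row. A letter takes the place of the letter that
it expels, so the letters expelled from one place increase over time and are all smaller than its
present occupant; this last property is what the induction has to carry.\<close>

lemma bumped_columns:
  assumes "distinct xs" "0 \<notin> set xs"
  shows "\<exists>cs h. chain_word cs (bumped xs) \<and> inj_on h (row xs) \<and> h ` row xs = set cs \<and>
            (\<forall>y\<in>row xs. \<forall>p<length xs. cs ! p = h y \<longrightarrow> bumped xs ! p < y)"
  using assms
proof (induction xs)
  case Nil
  show ?case by (rule exI[of _ "[]"]) (auto simp: chain_word_def)
next
  case (Cons x xs)
  then obtain cs h where ch: "chain_word cs (bumped xs)" and inj: "inj_on h (row xs)"
    and im: "h ` row xs = set cs"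
    and lt: "\<And>y p. y \<in> row xs \<Longrightarrow> p < length xs \<Longrightarrow> cs ! p = h y \<Longrightarrow> bumped xs ! p < y"
    by auto
  have lcs: "length cs = length xs" using ch by (simp add: chain_word_def)
  have nx: "x \<notin> row xs" "0 < x" "0 \<notin> row xs" using Cons.prems row_subset[of xs] by auto
  let ?o = "bump x (row xs)"
  have dec: "\<And>p q. p < q \<Longrightarrow> q < length xs \<Longrightarrow> cs ! p = cs ! q \<Longrightarrow> bumped xs ! q < bumped xs ! p"
    and zero: "\<And>q. q < length xs \<Longrightarrow> \<exists>p<length xs. cs ! p = cs ! q \<and> bumped xs ! p = 0"
    using ch by (auto simp: chain_word_def)
  have ox: "?o < x" using bump_mem(2)[OF nx(2)] .
  \<comment> \<open>The place of the new letter: the place of the expelled letter, or a fresh one.\<close>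
  obtain k where k: "k = (if ?o = 0 then Suc (Max (insert 0 (set cs))) else h ?o)" by blast
  have kfresh: "k \<notin> set cs" if "?o = 0"
  proof
    assume "k \<in> set cs"
    then have "k \<le> Max (insert 0 (set cs))" by simp
    then show False using k that by simp
  qed
  have oR: "?o \<in> row xs" if "?o \<noteq> 0" using bump_mem(1)[OF nx(2), of "row xs"] that by auto
  have kold: "bumped xs ! p < ?o" if "p < length xs" "cs ! p = k" for p
  proof (cases "?o = 0")
    case True
    then show ?thesis using kfresh that lcs by (metis nth_mem)
  next
    case False
    then show ?thesis using lt[OF oR] that k by auto
  qed
  have kz: "?o = 0 \<or> k \<in> set cs" using oR k im by force
  let ?h = "h(x := k)"
  have chain: "chain_word (k # cs) (bumped (x # xs))"
    unfolding chain_word_def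
  proof (intro conjI allI impI)
    show "length (k # cs) = length (bumped (x # xs))" using lcs by simp
  next
    fix p q assume "p < q \<and> q < length (bumped (x # xs)) \<and> (k # cs) ! p = (k # cs) ! q"
    then show "bumped (x # xs) ! q < bumped (x # xs) ! p"
      using kold dec by (cases p; cases q) auto
  next
    fix q assume q: "q < length (bumped (x # xs))"
    show "\<exists>p<length (bumped (x # xs)). (k # cs) ! p = (k # cs) ! q \<and> bumped (x # xs) ! p = 0"
    proof (cases "q = 0 \<and> ?o = 0")
      case True
      then show ?thesis by (intro exI[of _ 0]) auto
    next
      case False
      have "(k # cs) ! q \<in> set cs"
        using False kz q lcs by (cases q) auto
      then obtain q' where "q' < length xs" "cs ! q' = (k # cs) ! q"
        using lcs by (auto simp: in_set_conv_nth)
      with zero[of q'] obtain p where "p < length xs" "cs ! p = (k # cs) ! q" "bumped xs ! p = 0"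
        by auto
      then show ?thesis by (intro exI[of _ "Suc p"]) auto
    qed
  qed
  have hk: "h y \<noteq> k" if "y \<in> row xs" "y \<noteq> ?o" for y
  proof (cases "?o = 0")
    case True
    then show ?thesis using kfresh im that by auto
  next
    case False
    then show ?thesis using inj_onD[OF inj _ that(1) oR] that k by auto
  qed
  have "inj_on ?h (row (x # xs))"
  proof (rule inj_onI)
    fix y z assume "y \<in> row (x # xs)" "z \<in> row (x # xs)" "?h y = ?h z"
    then show "y = z" using hk inj_onD[OF inj, of y z]
      by (auto split: if_splits)
  qed
  moreover have "?h ` row (x # xs) = set (k # cs)"
  proof -
    have "?h ` row (x # xs) = insert k (h ` (row xs - {?o}))"
      using nx ox by (auto simp: image_iff)
    also have "\<dots> = insert k (h ` row xs)"
      using oR k nx by (cases "?o = 0") auto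
    finally show ?thesis using im by simp
  qed
  moreover have "\<forall>y\<in>row (x # xs). \<forall>p<length (x # xs). (k # cs) ! p = ?h y \<longrightarrow> bumped (x # xs) ! p < y"
  proof (intro ballI allI impI)
    fix y p assume y: "y \<in> row (x # xs)" and p: "p < length (x # xs)" and e: "(k # cs) ! p = ?h y"
    show "bumped (x # xs) ! p < y"
    proof (cases "y = x")
      case True
      then show ?thesis using e p ox kold by (cases p) (auto intro: less_trans)
    next
      case False
      then have yR: "y \<in> row xs" "y \<noteq> ?o" using y by auto
      then show ?thesis using e p hk[OF yR] lt[OF yR(1)] False by (cases p) auto
    qed
  qed
  ultimately show ?case using chain by blast
qed

lemma bumped_in_chain_words:
  assumes "xs \<in> permutations_of_set {1..n}"
  shows "bumped xs \<in> chain_words n"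
proof -
  have d: "distinct xs" "set xs = {1..n}" using assms by (auto simp: permutations_of_set_def)
  have l: "length xs = n" using d distinct_card[of xs] by simp
  have nz: "0 \<notin> set xs" using d by simp
  have "y < n" if "y \<in> set (bumped xs)" for y
    by (rule bumped_lt[OF nz _ that]) (simp add: d)
  moreover obtain cs where "chain_word cs (bumped xs)"
    using bumped_columns[OF d(1) nz] by blast
  ultimately show ?thesis unfolding chain_words_def using l by auto
qed

lemma finite_chain_words: "finite (chain_words n)"
proof (rule finite_subset)
  show "chain_words n \<subseteq> {w. set w \<subseteq> {..<n} \<and> length w = n}" by (auto simp: chain_words_def)
qed (simp add: finite_lists_length_eq)

text \<open>The word \<open>1 1 0 \<dots> 0\<close>, with the columns \<open>1 0\<close>, \<open>1 0\<close>, \<open>0\<close>, \<open>\<dots>\<close>, is not obtained from a permutation, for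
a letter that has been expelled cannot be expelled again. Two further positions with the letter \<open>0\<close>
are needed to complete its columns, hence \<open>n > 3\<close>.\<close>

lemma card_chain_words:
  assumes "3 < n"
  shows "fact n < card (chain_words n)"
proof -
  define m where "m = n - 2"
  have m: "n = m + 2" "2 \<le> m" using assms by (simp_all add: m_def)
  define w where "w = (1::nat) # 1 # replicate m 0"
  define cs where "cs = (0::nat) # 1 # [0..<m]"
  have wn: "w ! p = (if p < 2 then 1 else 0)" if "p < n" for p
  proof (cases "p < 2")
    case True
    then have "p = 0 \<or> p = 1" by linarith
    then show ?thesis by (auto simp: w_def)
  next
    case False
    then obtain k where "p = Suc (Suc k)" by (metis add_2_eq_Suc le_Suc_ex not_less)
    then show ?thesis using that m by (simp add: w_def)
  qed
  have cn: "cs ! p = (if p < 2 then p else p - 2)" if "p < n" for p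
  proof (cases "p < 2")
    case True
    then have "p = 0 \<or> p = 1" by linarith
    then show ?thesis by (auto simp: cs_def)
  next
    case False
    then obtain k where "p = Suc (Suc k)" by (metis add_2_eq_Suc le_Suc_ex not_less)
    then show ?thesis using that m by (simp add: cs_def)
  qed
  have lw: "length w = n" "length cs = n" using m by (simp_all add: w_def cs_def)
  have "chain_word cs w"
    unfolding chain_word_def lw
  proof (intro conjI allI impI refl)
    fix p q assume "p < q \<and> q < n \<and> cs ! p = cs ! q"
    then show "w ! q < w ! p"
      using cn[of p] cn[of q] wn[of p] wn[of q] by (auto split: if_splits)
  next
    fix q assume q: "q < n"
    show "\<exists>p<n. cs ! p = cs ! q \<and> w ! p = 0"
    proof (cases "q < 2")
      case True
      then show ?thesis using m q cn[of q] cn[of "q + 2"] wn[of "q + 2"]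
        by (intro exI[of _ "q + 2"]) simp
    next
      case False
      then show ?thesis using q wn[of q] by (intro exI[of _ q]) simp
    qed
  qed
  moreover have "set w \<subseteq> {..<n}" using m by (auto simp: w_def)
  ultimately have w: "w \<in> chain_words n"
    using lw by (auto simp: chain_words_def)
  have "w \<notin> bumped ` permutations_of_set {1..n}"
  proof
    assume "w \<in> bumped ` permutations_of_set {1..n}"
    then obtain xs where "xs \<in> permutations_of_set {1..n}" and xs: "bumped xs = w" by auto
    then have d: "set xs = {1..n}" by (auto simp: permutations_of_set_def)
    obtain x xs' where e: "xs = x # xs'" using xs by (cases xs) (simp_all add: w_def)
    obtain y ys where e': "xs' = y # ys" using xs e by (cases xs') (simp_all add: w_def)
    have b: "bump x (row (y # ys)) = 1" "bump y (row ys) = 1"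
      using xs unfolding e e' by (simp_all add: w_def del: row.simps)
    have "x \<in> {1..n}" using d e by auto
    then have "0 < x" by simp
    then have "1 \<in> row (y # ys)" using bump_mem(1)[of x "row (y # ys)"] unfolding b by simp
    then show False unfolding row.simps b by simp
  qed
  then have "bumped ` permutations_of_set {1..n} \<subset> chain_words n"
    using w bumped_in_chain_words by blast
  then have "card (bumped ` permutations_of_set {1..n}) < card (chain_words n)"
    by (rule psubset_card_mono[OF finite_chain_words])
  moreover have "card (bumped ` permutations_of_set {1..n}) = fact n"
    using card_image[OF bumped_inj_on_permutations[of n]] by simp
  ultimately show ?thesis by simp
qed

section \<open>Linear functionals and linear independence\<close>

definition linear_functional :: "('k::field, 'a, 'm) module_scheme \<Rightarrow> ('a \<Rightarrow> 'k) \<Rightarrow> bool" where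
  "linear_functional A L \<longleftrightarrow>
     (\<forall>x\<in>carrier A. \<forall>y\<in>carrier A. L (x \<oplus>\<^bsub>A\<^esub> y) = L x + L y) \<and>
     (\<forall>c. \<forall>x\<in>carrier A. L (c \<odot>\<^bsub>A\<^esub> x) = c * L x)"

lemma linear_functional_zero:
  assumes "Module.module class_ring A" "linear_functional A L"
  shows "L \<zero>\<^bsub>A\<^esub> = 0"
proof -
  interpret Module.module class_ring A by fact
  have "L (0 \<odot>\<^bsub>A\<^esub> \<zero>\<^bsub>A\<^esub>) = 0 * L \<zero>\<^bsub>A\<^esub>"
    using assms(2) M.zero_closed unfolding linear_functional_def by blast
  moreover have "0 \<odot>\<^bsub>A\<^esub> \<zero>\<^bsub>A\<^esub> = \<zero>\<^bsub>A\<^esub>" using lmult_0[of "\<zero>\<^bsub>A\<^esub>"] by simp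
  ultimately show ?thesis by simp
qed

lemma linear_functional_finsum:
  assumes "Module.module class_ring A" "linear_functional A L" "finite S" "g ` S \<subseteq> carrier A"
  shows "L (\<Oplus>\<^bsub>A\<^esub>i\<in>S. g i) = (\<Sum>i\<in>S. L (g i))"
proof -
  interpret Module.module class_ring A by fact
  show ?thesis using assms(3,4)
  proof (induction S rule: finite_induct)
    case empty
    then show ?case using linear_functional_zero[OF assms(1,2)] by simp
  next
    case (insert i S)
    then have "(\<Oplus>\<^bsub>A\<^esub>i\<in>insert i S. g i) = g i \<oplus>\<^bsub>A\<^esub> (\<Oplus>\<^bsub>A\<^esub>i\<in>S. g i)"
      by (intro M.finsum_insert) auto
    moreover have "g i \<in> carrier A" "(\<Oplus>\<^bsub>A\<^esub>i\<in>S. g i) \<in> carrier A"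
      using insert by (auto intro!: M.finsum_closed)
    ultimately show ?case using insert assms(2) by (simp add: linear_functional_def)
  qed
qed

text \<open>Apply \<open>L m\<close> to a vanishing linear combination, where \<open>m\<close> is the least index with nonzero
coefficient: by triangularity only the term of \<open>m\<close> survives.\<close>

lemma card_le_dim_if_triangular:
  fixes W :: "'i::linorder set"
  assumes V: "vectorspace class_ring V" and fd: "vectorspace.fin_dim class_ring V"
    and W: "finite W" and t: "\<And>w. w \<in> W \<Longrightarrow> t w \<in> carrier V"
    and L: "\<And>w. w \<in> W \<Longrightarrow> linear_functional V (L w)"
    and one: "\<And>w. w \<in> W \<Longrightarrow> L w (t w) = 1"
    and tri: "\<And>w w'. w \<in> W \<Longrightarrow> w' \<in> W \<Longrightarrow> L w (t w') \<noteq> 0 \<Longrightarrow> w' \<le> w"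
  shows "card W \<le> vectorspace.dim class_ring V"
proof -
  interpret vectorspace class_ring V by fact
  have mod: "Module.module class_ring V" ..
  have inj: "inj_on t W"
  proof (rule inj_onI)
    fix w w' assume "w \<in> W" "w' \<in> W" "t w = t w'"
    then show "w = w'" using one[of w] one[of w'] tri[of w w'] tri[of w' w] by fastforce
  qed
  have "lin_indpt (t ` W)"
  proof (rule finite_lin_indpt2)
    show "finite (t ` W)" "t ` W \<subseteq> carrier V" using W t by auto
  next
    fix a assume "lincomb a (t ` W) = \<zero>\<^bsub>V\<^esub>"
    have sum0: "(\<Sum>w'\<in>W. a (t w') * L w (t w')) = 0" if w: "w \<in> W" for w
    proof -
      have "0 = L w (\<Oplus>\<^bsub>V\<^esub>v\<in>t ` W. a v \<odot>\<^bsub>V\<^esub> v)"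
        using \<open>lincomb a (t ` W) = \<zero>\<^bsub>V\<^esub>\<close> linear_functional_zero[OF mod L[OF w]]
        by (simp add: lincomb_def)
      also have "\<dots> = (\<Sum>v\<in>t ` W. L w (a v \<odot>\<^bsub>V\<^esub> v))"
        using W t by (intro linear_functional_finsum[OF mod L[OF w]]) auto
      also have "\<dots> = (\<Sum>v\<in>t ` W. a v * L w v)"
        using L[OF w] t by (intro sum.cong) (auto simp: linear_functional_def)
      also have "\<dots> = (\<Sum>w'\<in>W. a (t w') * L w (t w'))"
        by (simp add: sum.reindex[OF inj])
      finally show ?thesis by simp
    qed
    have "a (t w) = 0" if "w \<in> W" for w
    proof (rule ccontr)
      assume "a (t w) \<noteq> 0"
      let ?D = "{w\<in>W. a (t w) \<noteq> 0}"
      define m where "m = Min ?D"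
      have "finite ?D" using W by simp
      moreover have "?D \<noteq> {}" using that \<open>a (t w) \<noteq> 0\<close> by auto
      ultimately have m: "m \<in> ?D" and mle: "\<And>w. w \<in> ?D \<Longrightarrow> m \<le> w"
        unfolding m_def using Min_in Min_le by blast+
      have "(\<Sum>w'\<in>W. a (t w') * L m (t w')) = (\<Sum>w'\<in>{m}. a (t w') * L m (t w'))"
      proof (rule sum.mono_neutral_right[OF W])
        show "{m} \<subseteq> W" using m by auto
        show "\<forall>i\<in>W - {m}. a (t i) * L m (t i) = 0"
          using m mle tri[of m] by (fastforce dest: antisym)
      qed
      also have "\<dots> = a (t m)" using one m by simp
      finally show False using sum0[of m] m by simp
    qed
    then show "\<forall>v\<in>t ` W. a v = \<zero>\<^bsub>class_ring\<^esub>" by simp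
  qed
  then have "card (t ` W) \<le> dim" using t by (intro li_le_dim(2)[OF fd]) auto
  then show ?thesis by (simp add: card_image[OF inj])
qed

section \<open>Column determinants\<close>

text \<open>The matrix is block diagonal up to a simultaneous permutation of rows and columns, with one block
for every column of the word, so its determinant is the product of the column determinants. The
argument \<open>u p b\<close> is the coordinate number \<open>b\<close> of the tensor factor in position \<open>p\<close>.\<close>

definition chain_matrix :: "nat list \<Rightarrow> nat list \<Rightarrow> (nat \<Rightarrow> nat \<Rightarrow> 'k::comm_ring_1) \<Rightarrow> 'k mat" where
  "chain_matrix cs w u = mat (length w) (length w)
     (\<lambda>(p, q). if cs ! p = cs ! q then u p (w ! q) else 0)"

lemma chain_matrix_carrier [simp]: "chain_matrix cs w u \<in> carrier_mat (length w) (length w)"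
  by (simp add: chain_matrix_def)

lemma det_chain_matrix:
  "det (chain_matrix cs w u) =
     (\<Sum>\<pi> | \<pi> permutes {0..<length w}.
        signof \<pi> * (\<Prod>i = 0..<length w. if cs ! i = cs ! \<pi> i then u i (w ! \<pi> i) else 0))"
proof -
  have "(\<Prod>i = 0..<length w. chain_matrix cs w u $$ (i, \<pi> i)) =
        (\<Prod>i = 0..<length w. if cs ! i = cs ! \<pi> i then u i (w ! \<pi> i) else 0)"
    if "\<pi> permutes {0..<length w}" for \<pi>
  proof (rule prod.cong[OF refl])
    fix i assume "i \<in> {0..<length w}"
    then show "chain_matrix cs w u $$ (i, \<pi> i) = (if cs ! i = cs ! \<pi> i then u i (w ! \<pi> i) else 0)"
      using permutes_in_image[OF that, of i] by (simp add: chain_matrix_def)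
  qed
  then show ?thesis
    unfolding det_def'[OF chain_matrix_carrier] by (intro sum.cong) auto
qed

lemma chain_word_inj:
  assumes "chain_word cs w" "p < length w" "q < length w" "cs ! p = cs ! q" "w ! p = w ! q"
  shows "p = q"
proof (rule ccontr)
  assume "p \<noteq> q"
  then consider "p < q" | "q < p" by linarith
  then show False
    using assms unfolding chain_word_def by cases (metis less_irrefl)+
qed

lemma det_chain_matrix_self:
  assumes "chain_word cs w"
  shows "det (chain_matrix cs w (\<lambda>p b. if b = w ! p then 1 else 0)) = (1 :: 'k::comm_ring_1)"
proof -
  have "chain_matrix cs w (\<lambda>p b. if b = w ! p then 1 else 0) = (1\<^sub>m (length w) :: 'k mat)"
    by (rule eq_matI) (use chain_word_inj[OF assms] in \<open>auto simp: chain_matrix_def\<close>)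
  then show ?thesis by simp
qed

text \<open>A nonzero determinant has a nonzero term in its Leibniz expansion, that is, a permutation \<open>\<pi>\<close> that
preserves columns and carries \<open>w\<close> to \<open>w'\<close>. Before the first position \<open>p\<close> where the words differ, \<open>\<pi>\<close> is
the identity, so \<open>\<pi> p\<close> lies further down in the column of \<open>p\<close> and carries a smaller letter.\<close>

lemma det_chain_matrix_lex:
  assumes ch: "chain_word cs w" and len: "length w' = length w"
    and nz: "det (chain_matrix cs w (\<lambda>p b. if b = w' ! p then 1 else 0)) \<noteq> (0 :: 'k::comm_ring_1)"
  shows "w' \<le> w"
proof (cases "w' = w")
  case False
  let ?n = "length w"
  have "\<exists>\<pi>. \<pi> permutes {0..<?n} \<and>
      (\<Prod>i = 0..<?n. if cs ! i = cs ! \<pi> i then if w ! \<pi> i = w' ! i then 1 else 0 else 0) \<noteq> (0::'k)"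
  proof (rule ccontr)
    assume "\<not> ?thesis"
    then have "det (chain_matrix cs w (\<lambda>p b. if b = w' ! p then 1 else 0)) = (0::'k)"
      unfolding det_chain_matrix by (intro sum.neutral) simp
    then show False using nz by simp
  qed
  then obtain \<pi> where pi: "\<pi> permutes {0..<?n}"
    and nzp: "(\<Prod>i = 0..<?n. if cs ! i = cs ! \<pi> i then if w ! \<pi> i = w' ! i then 1 else 0 else 0) \<noteq> (0::'k)"
    by blast
  have entry: "cs ! i = cs ! \<pi> i \<and> w ! \<pi> i = w' ! i" if i: "i < ?n" for i
  proof (rule ccontr)
    assume "\<not> (cs ! i = cs ! \<pi> i \<and> w ! \<pi> i = w' ! i)"
    then have "(if cs ! i = cs ! \<pi> i then if w ! \<pi> i = w' ! i then 1 else 0 else 0) = (0::'k)"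
      by auto
    then have "\<exists>i\<in>{0..<?n}. (if cs ! i = cs ! \<pi> i then if w ! \<pi> i = w' ! i then 1 else 0 else 0) = (0::'k)"
      using i by (intro bexI[of _ i]) simp_all
    from prod_zero[OF finite_atLeastLessThan this] nzp show False by (rule notE[rotated])
  qed
  have col: "cs ! i = cs ! \<pi> i" if "i < ?n" for i
    using entry[OF that] ..
  have val: "w ! \<pi> i = w' ! i" if "i < ?n" for i
    using entry[OF that] ..
  have inj: "\<pi> i = \<pi> j \<Longrightarrow> i = j" for i j using permutes_inj[OF pi] by (rule injD)
  have lt: "\<pi> i < ?n" if "i < ?n" for i using permutes_in_image[OF pi, of i] that by simp
  define p where "p = (LEAST p. p < ?n \<and> w ! p \<noteq> w' ! p)"
  have ex: "\<exists>p. p < ?n \<and> w ! p \<noteq> w' ! p" using False len nth_equalityI[of w w'] by auto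
  have p: "p < ?n" "w ! p \<noteq> w' ! p" unfolding p_def using LeastI_ex[OF ex] by auto
  have before: "w ! q = w' ! q" if "q < p" for q
    using that not_less_Least[of q "\<lambda>p. p < ?n \<and> w ! p \<noteq> w' ! p"] p(1) by (auto simp: p_def)
  have fix_before: "\<pi> q = q" if "q < p" for q
  proof -
    have q: "q < ?n" using that p(1) by simp
    show ?thesis
      using chain_word_inj[OF ch q lt[OF q] col[OF q]] val[OF q] before[OF that] by simp
  qed
  have "\<not> \<pi> p < p" using fix_before[of "\<pi> p"] inj[of "\<pi> p" p] by auto
  moreover have "\<pi> p \<noteq> p" using val[OF p(1)] p(2) by auto
  ultimately have "p < \<pi> p" by simp
  then have "w ! \<pi> p < w ! p"
    using ch lt[OF p(1)] col[OF p(1)] by (simp add: chain_word_def)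
  then have "w' ! p < w ! p" using val[OF p(1)] by simp
  moreover have "take p w' = take p w"
    using before p(1) len by (intro nth_equalityI) auto
  ultimately have "w' < w"
    unfolding list_less_def lexord_take_index_conv using p(1) len by auto
  then show ?thesis by simp
qed simp

lemma coeff_prod_linear:
  fixes x y :: "'i \<Rightarrow> 'k::comm_ring_1"
  assumes I: "finite I"
  shows "coeff (\<Prod>i\<in>I. [:x i, y i:]) j =
           (\<Sum>S | S \<subseteq> I \<and> card S = j. \<Prod>i\<in>I. if i \<in> S then y i else x i)"
proof -
  have m: "(\<Prod>i\<in>S. [:0, y i:]) = monom (\<Prod>i\<in>S. y i) (card S)" if "finite S" for S
    using that
  proof (induction S rule: finite_induct)
    case (insert i S)
    have "[:0, y i:] = monom (y i) 1" by (simp add: monom_Suc monom_0)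
    then show ?case using insert by (simp add: mult_monom)
  qed simp
  have c: "(\<Prod>i\<in>S. [:x i:]) = [:\<Prod>i\<in>S. x i:]" for S
    by (induction S rule: infinite_finite_induct) (auto simp: one_pCons)
  have "(\<Prod>i\<in>I. [:x i, y i:]) = (\<Prod>i\<in>I. [:0, y i:] + [:x i:])" by simp
  also have "\<dots> = (\<Sum>S\<in>Pow I. (\<Prod>i\<in>S. [:0, y i:]) * (\<Prod>i\<in>I - S. [:x i:]))"
    by (rule prod_add[OF I])
  also have "\<dots> = (\<Sum>S\<in>Pow I. monom ((\<Prod>i\<in>S. y i) * (\<Prod>i\<in>I - S. x i)) (card S))"
  proof (rule sum.cong[OF refl])
    fix S assume "S \<in> Pow I"
    then have "finite S" using I finite_subset by auto
    then show "(\<Prod>i\<in>S. [:0, y i:]) * (\<Prod>i\<in>I - S. [:x i:]) =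
        monom ((\<Prod>i\<in>S. y i) * (\<Prod>i\<in>I - S. x i)) (card S)"
      unfolding m[OF \<open>finite S\<close>] c by (simp add: smult_monom mult.commute)
  qed
  also have "coeff \<dots> j = (\<Sum>S\<in>Pow I. if card S = j then (\<Prod>i\<in>S. y i) * (\<Prod>i\<in>I - S. x i) else 0)"
    by (simp add: coeff_sum)
  also have "\<dots> = (\<Sum>S | S \<subseteq> I \<and> card S = j. (\<Prod>i\<in>S. y i) * (\<Prod>i\<in>I - S. x i))"
    using I by (intro sum.mono_neutral_cong_right) auto
  also have "\<dots> = (\<Sum>S | S \<subseteq> I \<and> card S = j. \<Prod>i\<in>I. if i \<in> S then y i else x i)"
  proof (rule sum.cong[OF refl])
    fix S assume "S \<in> {S. S \<subseteq> I \<and> card S = j}"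
    then have "I \<inter> S = S" "I \<inter> - S = I - S" by auto
    then show "(\<Prod>i\<in>S. y i) * (\<Prod>i\<in>I - S. x i) = (\<Prod>i\<in>I. if i \<in> S then y i else x i)"
      using I by (simp add: prod.If_cases)
  qed
  finally show ?thesis .
qed

lemma det_chain_matrix_const:
  "det (chain_matrix cs w (\<lambda>p b. [:u p b:])) = [:det (chain_matrix cs w u):]"
proof -
  interpret comm_ring_hom "\<lambda>x::'a. [:x:]"
    by unfold_locales (simp_all add: one_pCons)
  have "chain_matrix cs w (\<lambda>p b. [:u p b:]) = map_mat (\<lambda>x. [:x:]) (chain_matrix cs w u)"
    by (rule eq_matI) (auto simp: chain_matrix_def)
  then show ?thesis by simp
qed

text \<open>Multiplying the tensor factors by \<open>1 - z a\<close> acts on the coordinate matrix from the right by a triangular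
matrix \<open>E\<close>. Here \<open>\<alpha>\<close> are the coordinates of \<open>a\<close>, \<open>v\<close> those of the factors multiplied by \<open>a\<close>, and the
polynomial variable is \<open>z\<close>.\<close>

lemma det_chain_matrix_one_minus:
  fixes u v :: "nat \<Rightarrow> nat \<Rightarrow> 'k::idom"
  assumes ch: "chain_word cs w"
    and v0: "\<And>p. v p 0 = \<alpha> 0 * u p 0"
    and vb: "\<And>p b. b \<noteq> 0 \<Longrightarrow> v p b = \<alpha> 0 * u p b + \<alpha> b * u p 0"
  shows "det (chain_matrix cs w (\<lambda>p b. [:u p b, - v p b:])) =
           [:det (chain_matrix cs w u):] * [:1, - \<alpha> 0:] ^ length w"
proof -
  let ?n = "length w"
  \<comment> \<open>The position of the letter 0 in the column of \<open>q\<close>.\<close>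
  define r where "r q = (SOME p. p < ?n \<and> cs ! p = cs ! q \<and> w ! p = 0)" for q
  have r: "r q < ?n" "cs ! r q = cs ! q" "w ! r q = 0" if "q < ?n" for q
  proof -
    have "\<exists>p. p < ?n \<and> cs ! p = cs ! q \<and> w ! p = 0" using ch that by (auto simp: chain_word_def)
    from someI_ex[OF this] show "r q < ?n" "cs ! r q = cs ! q" "w ! r q = 0"
      by (simp_all add: r_def)
  qed
  have rq: "q < r q" if "q < ?n" "w ! q \<noteq> 0" for q
  proof (rule ccontr)
    assume "\<not> q < r q"
    moreover have "r q \<noteq> q" using r(3)[OF that(1)] that(2) by auto
    ultimately have "r q < q" by simp
    then have "w ! q < w ! r q" using ch r(2)[OF that(1)] that(1) by (simp add: chain_word_def)
    then show False using r(3)[OF that(1)] by simp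
  qed
  define E where "E = mat ?n ?n (\<lambda>(i, q). (if i = q then [:1, - \<alpha> 0:] else 0) +
      (if i = r q \<and> w ! q \<noteq> 0 then [:0, - \<alpha> (w ! q):] else 0))"
  let ?M = "chain_matrix cs w (\<lambda>p b. [:u p b:])"
  have E: "E \<in> carrier_mat ?n ?n" by (simp add: E_def)
  have "chain_matrix cs w (\<lambda>p b. [:u p b, - v p b:]) = ?M * E"
  proof (rule eq_matI)
    fix p q assume "p < dim_row (?M * E)" "q < dim_col (?M * E)"
    then have p: "p < ?n" and q: "q < ?n" by (simp_all add: chain_matrix_def E_def)
    have "(?M * E) $$ (p, q) = (\<Sum>i = 0..<?n. ?M $$ (p, i) * E $$ (i, q))"
      using p q by (simp add: scalar_prod_def chain_matrix_def E_def)
    also have "\<dots> = (\<Sum>i = 0..<?n. (if i = q then ?M $$ (p, q) * [:1, - \<alpha> 0:] else 0) +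
        (if i = r q then ?M $$ (p, r q) * (if w ! q \<noteq> 0 then [:0, - \<alpha> (w ! q):] else 0) else 0))"
      by (rule sum.cong) (use q in \<open>auto simp: E_def algebra_simps\<close>)
    also have "\<dots> = ?M $$ (p, q) * [:1, - \<alpha> 0:] +
        ?M $$ (p, r q) * (if w ! q \<noteq> 0 then [:0, - \<alpha> (w ! q):] else 0)"
      unfolding sum.distrib using q r(1)[OF q] by simp
    also have "\<dots> = chain_matrix cs w (\<lambda>p b. [:u p b, - v p b:]) $$ (p, q)"
      using p q r[OF q] v0 vb by (auto simp: chain_matrix_def algebra_simps)
    finally show "chain_matrix cs w (\<lambda>p b. [:u p b, - v p b:]) $$ (p, q) = (?M * E) $$ (p, q)" ..
  qed (simp_all add: chain_matrix_def E_def)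
  then have "det (chain_matrix cs w (\<lambda>p b. [:u p b, - v p b:])) = det ?M * det E"
    using det_mult[OF chain_matrix_carrier E] by simp
  also have "det E = prod_list (diag_mat E)"
  proof (rule det_lower_triangular[OF _ E])
    fix i j assume "i < j" "j < ?n"
    then show "E $$ (i, j) = 0" using rq[of j] by (auto simp: E_def)
  qed
  also have "diag_mat E = replicate ?n [:1, - \<alpha> 0:]"
    by (rule nth_equalityI) (use rq in \<open>fastforce simp: diag_mat_def E_def\<close>)+
  also have "prod_list (replicate ?n [:1, - \<alpha> 0:]) = [:1, - \<alpha> 0:] ^ ?n"
    by (simp add: prod_list_replicate)
  finally show ?thesis by (simp add: det_chain_matrix_const)
qed

text \<open>This compares the coefficients of \<open>z\<^sup>j\<close> in \<open>det_chain_matrix_one_minus\<close>: expanding the left side there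
multilinearly, a set \<open>S\<close> of tensor factors multiplied by \<open>- z a\<close> contributes to the coefficient of \<open>z\<^sup>j\<close> for
\<open>j = card S\<close>.\<close>

lemma sum_det_chain_matrix_subsets:
  fixes u v :: "nat \<Rightarrow> nat \<Rightarrow> 'k::idom"
  assumes ch: "chain_word cs w"
    and v0: "\<And>p. v p 0 = \<alpha> 0 * u p 0"
    and vb: "\<And>p b. b \<noteq> 0 \<Longrightarrow> v p b = \<alpha> 0 * u p b + \<alpha> b * u p 0"
  shows "(\<Sum>S | S \<subseteq> {0..<length w} \<and> card S = j.
            det (chain_matrix cs w (\<lambda>p. if p \<in> S then v p else u p))) =
         (- 1) ^ j * coeff ([:1, - \<alpha> 0:] ^ length w) j * det (chain_matrix cs w u)"
proof -
  let ?n = "length w"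
  let ?P = "{\<pi>. \<pi> permutes {0..<?n}}"
  let ?SS = "{S. S \<subseteq> {0..<?n} \<and> card S = j}"
  let ?e = "\<lambda>f \<pi> i. if cs ! i = cs ! \<pi> i then f i (w ! \<pi> i) else (0::'k)"
  let ?x = "\<lambda>S p. if p \<in> S then v p else u p"
  have eq: "det (chain_matrix cs w (\<lambda>p b. [:u p b, - v p b:])) =
      [:det (chain_matrix cs w u):] * [:1, - \<alpha> 0:] ^ ?n"
    using ch v0 vb by (rule det_chain_matrix_one_minus)
  have "det (chain_matrix cs w u) * coeff ([:1, - \<alpha> 0:] ^ ?n) j =
      coeff (det (chain_matrix cs w (\<lambda>p b. [:u p b, - v p b:]))) j"
    unfolding eq by simp
  also have "\<dots> = (\<Sum>\<pi>\<in>?P. signof \<pi> * coeff (\<Prod>i = 0..<?n. [:?e u \<pi> i, - ?e v \<pi> i:]) j)"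
  proof -
    have *: "(if cs ! i = cs ! \<pi> i then [:u i (w ! \<pi> i), - v i (w ! \<pi> i):] else 0) =
        [:?e u \<pi> i, - ?e v \<pi> i:]" for i \<pi>
      by simp
    have **: "coeff (signof \<pi> * p) j = signof \<pi> * coeff p j" for \<pi> :: "nat \<Rightarrow> nat" and p :: "'k poly"
      by (simp add: sign_def)
    show ?thesis unfolding det_chain_matrix * coeff_sum ** ..
  qed
  also have "\<dots> = (\<Sum>\<pi>\<in>?P. \<Sum>S\<in>?SS. (- 1) ^ j * (signof \<pi> * (\<Prod>i = 0..<?n. ?e (?x S) \<pi> i)))"
  proof (rule sum.cong[OF refl])
    fix \<pi> assume "\<pi> \<in> ?P"
    have "(\<Prod>i = 0..<?n. if i \<in> S then - ?e v \<pi> i else ?e u \<pi> i) =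
        (- 1) ^ j * (\<Prod>i = 0..<?n. ?e (?x S) \<pi> i)" if "S \<in> ?SS" for S
    proof -
      have "(\<Prod>i = 0..<?n. if i \<in> S then - ?e v \<pi> i else ?e u \<pi> i) =
          (\<Prod>i = 0..<?n. (if i \<in> S then - 1 else 1) * ?e (?x S) \<pi> i)"
        by (rule prod.cong) auto
      also have "\<dots> = (\<Prod>i = 0..<?n. if i \<in> S then - 1 else 1) * (\<Prod>i = 0..<?n. ?e (?x S) \<pi> i)"
        by (rule prod.distrib)
      also have "(\<Prod>i = 0..<?n. if i \<in> S then - 1 else (1::'k)) = (- 1) ^ j"
      proof -
        have "{0..<?n} \<inter> S = S" using that by auto
        then show ?thesis using that by (simp add: prod.If_cases)
      qed
      finally show ?thesis .
    qed
    then show "signof \<pi> * coeff (\<Prod>i = 0..<?n. [:?e u \<pi> i, - ?e v \<pi> i:]) j =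
        (\<Sum>S\<in>?SS. (- 1) ^ j * (signof \<pi> * (\<Prod>i = 0..<?n. ?e (?x S) \<pi> i)))"
      unfolding coeff_prod_linear[OF finite_atLeastLessThan] sum_distrib_left
      by (intro sum.cong) auto
  qed
  also have "\<dots> = (\<Sum>S\<in>?SS. \<Sum>\<pi>\<in>?P. (- 1) ^ j * (signof \<pi> * (\<Prod>i = 0..<?n. ?e (?x S) \<pi> i)))"
    by (rule sum.swap)
  also have "\<dots> = (- 1) ^ j * (\<Sum>S\<in>?SS. det (chain_matrix cs w (?x S)))"
    unfolding det_chain_matrix sum_distrib_left ..
  finally have "(- 1) ^ j * (det (chain_matrix cs w u) * coeff ([:1, - \<alpha> 0:] ^ ?n) j) =
      ((- 1) ^ j * (- 1) ^ j) * (\<Sum>S\<in>?SS. det (chain_matrix cs w (?x S)))"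
    by (simp add: mult.assoc)
  also have "(- 1) ^ j * (- 1) ^ j = (1::'k)" by (simp add: power_add[symmetric] mult_2[symmetric] power_mult)
  finally show ?thesis by (simp add: mult.commute mult.left_commute)
qed

lemma det_chain_matrix_cong:
  assumes "\<And>p q. p < length w \<Longrightarrow> q < length w \<Longrightarrow> u p (w ! q) = u' p (w ! q)"
  shows "det (chain_matrix cs w u) = det (chain_matrix cs w u')"
proof -
  have "chain_matrix cs w u = chain_matrix cs w u'"
    by (rule eq_matI) (auto simp: chain_matrix_def assms)
  then show ?thesis by simp
qed

text \<open>Expansion along row \<open>i\<close>, in which the entries \<open>y\<close> of that row occur linearly.\<close>

lemma det_chain_matrix_row:
  assumes i: "i < length w"
  shows "det (chain_matrix cs w (u(i := y))) =
     (\<Sum>\<pi> | \<pi> permutes {0..<length w}. (if cs ! i = cs ! \<pi> i then y (w ! \<pi> i) else 0) *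
        (signof \<pi> * (\<Prod>k\<in>{0..<length w} - {i}. if cs ! k = cs ! \<pi> k then u k (w ! \<pi> k) else 0)))"
proof -
  have "(\<Prod>k = 0..<length w. if cs ! k = cs ! \<pi> k then (u(i := y)) k (w ! \<pi> k) else 0) =
      (if cs ! i = cs ! \<pi> i then y (w ! \<pi> i) else 0) *
        (\<Prod>k\<in>{0..<length w} - {i}. if cs ! k = cs ! \<pi> k then u k (w ! \<pi> k) else 0)" for \<pi>
  proof -
    have "(\<Prod>k\<in>{0..<length w} - {i}. if cs ! k = cs ! \<pi> k then (u(i := y)) k (w ! \<pi> k) else 0) =
        (\<Prod>k\<in>{0..<length w} - {i}. if cs ! k = cs ! \<pi> k then u k (w ! \<pi> k) else 0)"
      by (rule prod.cong) simp_all
    moreover have "i \<in> {0..<length w}" using i by simp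
    ultimately show ?thesis by (simp only: prod.remove[OF finite_atLeastLessThan] fun_upd_same)
  qed
  then show ?thesis unfolding det_chain_matrix by (intro sum.cong refl) (simp only: mult_ac)
qed

lemma det_chain_matrix_row_add:
  assumes "i < length w"
  shows "det (chain_matrix cs w (u(i := (\<lambda>b. y b + z b)))) =
     det (chain_matrix cs w (u(i := y))) + det (chain_matrix cs w (u(i := z)))"
  unfolding det_chain_matrix_row[OF assms] sum.distrib[symmetric]
  by (rule sum.cong) (auto simp: algebra_simps)

lemma det_chain_matrix_row_smult:
  assumes "i < length w"
  shows "det (chain_matrix cs w (u(i := (\<lambda>b. c * y b)))) = c * det (chain_matrix cs w (u(i := y)))"
  unfolding det_chain_matrix_row[OF assms] sum_distrib_left
  by (rule sum.cong) (auto simp: algebra_simps)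

section \<open>Algebras over a field and their quotients\<close>

text \<open>The quotient of an algebra extends the record of the quotient ring by a scalar multiplication, so its ring
structure has to be carried over from a record of another type.\<close>

lemma cring_cong:
  assumes "cring Q" "carrier P = carrier Q" "monoid.mult P = monoid.mult Q" "one P = one Q"
    "zero P = zero Q" "add P = add Q"
  shows "cring P"
proof -
  interpret Q: cring Q by fact
  show ?thesis
  proof (rule cringI)
    show "abelian_group P"
    proof (rule abelian_groupI)
      fix x assume "x \<in> carrier P"
      then show "\<exists>y\<in>carrier P. y \<oplus>\<^bsub>P\<^esub> x = \<zero>\<^bsub>P\<^esub>"
        unfolding assms(2-6) by (intro bexI[of _ "\<ominus>\<^bsub>Q\<^esub> x"]) (simp_all add: Q.l_neg)
    qed (simp_all add: assms(2-6) Q.a_ac)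
    show "comm_monoid P"
      by (rule comm_monoidI) (simp_all add: assms(2-6) Q.m_ac)
  qed (simp add: assms(2-6) Q.l_distr)
qed

locale field_algebra = algebra class_ring A
  for A :: "('k::field, 'a, 'm) module_scheme" (structure)
begin

lemma is_module: "Module.module class_ring A" ..

lemma is_vectorspace: "vectorspace class_ring A"
  using class_field is_module by (simp add: vectorspace_def)

lemma smult_add_left: "x \<in> carrier A \<Longrightarrow> (a + b) \<odot> x = a \<odot> x \<oplus> b \<odot> x"
  using smult_l_distr[of a b x] by simp

lemma smult_mult_left: "x \<in> carrier A \<Longrightarrow> (a * b) \<odot> x = a \<odot> (b \<odot> x)"
  using smult_assoc1[of a b x] by simp

lemma smult_1_left [simp]: "x \<in> carrier A \<Longrightarrow> 1 \<odot> x = x"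
  using smult_one[of x] by simp

lemma ideal_smult_closed:
  assumes "ideal I A" "x \<in> I"
  shows "c \<odot> x \<in> I"
proof -
  interpret ideal I A by fact
  have x: "x \<in> carrier A" using assms(2) by (rule a_Hcarr)
  have "c \<odot> x = (c \<odot> \<one>) \<otimes> x" using smult_assoc2[of c \<one> x] x by simp
  also have "\<dots> \<in> I" using assms(2) by (intro I_l_closed) auto
  finally show ?thesis .
qed

text \<open>The elements all of whose multiples are annihilated by \<open>L\<close> form an ideal, the largest one on which
\<open>L\<close> vanishes. It therefore suffices to test \<open>L\<close> on the multiples of generators.\<close>

lemma functional_vanishes_on_genideal:
  assumes L: "linear_functional A L" and X: "X \<subseteq> carrier A"
    and van: "\<And>x y. x \<in> X \<Longrightarrow> y \<in> carrier A \<Longrightarrow> L (x \<otimes> y) = 0"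
    and z: "z \<in> Idl X"
  shows "L z = 0"
proof -
  let ?N = "{x \<in> carrier A. \<forall>y\<in>carrier A. L (x \<otimes> y) = 0}"
  have add: "L (x \<oplus> y) = L x + L y" if "x \<in> carrier A" "y \<in> carrier A" for x y
    using L that by (simp add: linear_functional_def)
  have "ideal ?N A"
  proof (rule idealI)
    show "ring A" ..
    show "subgroup ?N (add_monoid A)"
    proof (rule add.subgroupI)
      show "?N \<subseteq> carrier A" by auto
      show "?N \<noteq> {}"
        using linear_functional_zero[OF is_module L] by (auto intro!: exI[of _ \<zero>])
    next
      fix a assume a: "a \<in> ?N"
      have "L (\<ominus> a \<otimes> y) = 0" if y: "y \<in> carrier A" for y
      proof -
        have "\<ominus> a \<otimes> y = a \<otimes> \<ominus> y" using a y by (simp add: l_minus r_minus)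
        then show ?thesis using a y by simp
      qed
      then show "\<ominus> a \<in> ?N" using a by simp
    next
      fix a b assume "a \<in> ?N" "b \<in> ?N"
      then show "a \<oplus> b \<in> ?N" by (auto simp: l_distr add)
    qed
  next
    fix a x assume a: "a \<in> ?N" and x: "x \<in> carrier A"
    have *: "L (a \<otimes> x \<otimes> y) = 0" if "y \<in> carrier A" for y
      using a x that by (simp add: m_assoc)
    then show "a \<otimes> x \<in> ?N" using a x by simp
    show "x \<otimes> a \<in> ?N" using * a x by (simp add: m_comm)
  qed
  moreover have "X \<subseteq> ?N" using X van by auto
  ultimately have "Idl X \<subseteq> ?N" by (rule genideal_minimal)
  then have "z \<in> carrier A" "L (z \<otimes> \<one>) = 0" using z by auto
  then show ?thesis by simp
qed

end

locale algebra_quotient = field_algebra A + ideal I A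
  for A :: "('k::field, 'a, 'm) module_scheme" (structure) and I
begin

abbreviation Q :: "('k, 'a set) module" where "Q \<equiv> quotient_algebra A I"

abbreviation proj :: "'a \<Rightarrow> 'a set" where "proj x \<equiv> I +> x"

lemma quotient_one: "\<one>\<^bsub>Q\<^esub> = proj \<one>"
  by (simp add: quotient_algebra_def FactRing_def)

lemma quotient_carrier: "carrier Q = proj ` carrier A"
  by (auto simp: quotient_algebra_def FactRing_def A_RCOSETS_def')

lemma quotient_mult: "x \<in> carrier A \<Longrightarrow> y \<in> carrier A \<Longrightarrow> proj x \<otimes>\<^bsub>Q\<^esub> proj y = proj (x \<otimes> y)"
  by (simp add: quotient_algebra_def FactRing_def rcoset_mult_add)

lemma quotient_add: "x \<in> carrier A \<Longrightarrow> y \<in> carrier A \<Longrightarrow> proj x \<oplus>\<^bsub>Q\<^esub> proj y = proj (x \<oplus> y)"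
  by (simp add: quotient_algebra_def FactRing_def a_rcos_sum)

lemma quotient_smult:
  assumes x: "x \<in> carrier A"
  shows "c \<odot>\<^bsub>Q\<^esub> proj x = proj (c \<odot> x)"
proof -
  have "proj (c \<odot> z) = proj (c \<odot> x)" if z: "z \<in> proj x" for z
  proof -
    obtain i where i: "i \<in> I" "z = i \<oplus> x" using z unfolding a_r_coset_def' by blast
    then have iA: "i \<in> carrier A" by (auto intro: a_Hcarr)
    have "c \<odot> z = c \<odot> i \<oplus> c \<odot> x" using i iA x by (simp add: smult_r_distr)
    moreover have "c \<odot> i \<in> I" using ideal_smult_closed[OF is_ideal i(1)] .
    ultimately have "c \<odot> z \<in> proj (c \<odot> x)" unfolding a_r_coset_def' by blast
    then show ?thesis
      by (rule a_repr_independence[OF _ _ a_subgroup, symmetric]) (use x in simp)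
  qed
  moreover have "x \<in> proj x" using x by (rule a_rcos_self)
  ultimately have "(\<Union>z\<in>proj x. proj (c \<odot> z)) = proj (c \<odot> x)" by blast
  then show ?thesis by (simp add: quotient_algebra_def)
qed

lemma quotient_zero_iff: "x \<in> carrier A \<Longrightarrow> proj x = \<zero>\<^bsub>Q\<^esub> \<longleftrightarrow> x \<in> I"
proof -
  assume x: "x \<in> carrier A"
  have "\<zero>\<^bsub>Q\<^esub> = I" by (simp add: quotient_algebra_def FactRing_def)
  then show ?thesis
    using a_coset_join1[OF _ x a_subgroup] a_coset_join2[OF x a_subgroup] by metis
qed

lemma quotient_is_algebra: "field_algebra Q"
proof -
  interpret QR: cring "A Quot I" by (rule quotient_is_cring[OF is_cring])
  have Q: "cring Q"
    by (rule cring_cong[OF QR.is_cring]) (simp_all add: quotient_algebra_def)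
  have "algebra class_ring Q"
  proof (rule algebraI)
    fix a b :: 'k and X Y assume "X \<in> carrier Q" "Y \<in> carrier Q"
    then obtain x y where x: "x \<in> carrier A" and X: "X = proj x"
      and y: "y \<in> carrier A" and Y: "Y = proj y"
      unfolding quotient_carrier by blast
    show "(a \<odot>\<^bsub>Q\<^esub> X) \<otimes>\<^bsub>Q\<^esub> Y = a \<odot>\<^bsub>Q\<^esub> (X \<otimes>\<^bsub>Q\<^esub> Y)"
      using x y by (simp add: X Y quotient_smult quotient_mult smult_assoc2)
    show "a \<odot>\<^bsub>Q\<^esub> (X \<oplus>\<^bsub>Q\<^esub> Y) = (a \<odot>\<^bsub>Q\<^esub> X) \<oplus>\<^bsub>Q\<^esub> (a \<odot>\<^bsub>Q\<^esub> Y)"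
      using x y by (simp add: X Y quotient_smult quotient_add smult_r_distr)
  next
    fix a b :: 'k and X assume "X \<in> carrier Q"
    then obtain x where x: "x \<in> carrier A" and X: "X = proj x"
      unfolding quotient_carrier by blast
    show "a \<odot>\<^bsub>Q\<^esub> X \<in> carrier Q"
      using x by (simp add: X quotient_smult quotient_carrier)
    show "(a \<oplus>\<^bsub>class_ring\<^esub> b) \<odot>\<^bsub>Q\<^esub> X = (a \<odot>\<^bsub>Q\<^esub> X) \<oplus>\<^bsub>Q\<^esub> (b \<odot>\<^bsub>Q\<^esub> X)"
      using x by (simp add: X quotient_smult quotient_add smult_add_left)
    show "(a \<otimes>\<^bsub>class_ring\<^esub> b) \<odot>\<^bsub>Q\<^esub> X = a \<odot>\<^bsub>Q\<^esub> (b \<odot>\<^bsub>Q\<^esub> X)"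
      using x by (simp add: X quotient_smult smult_mult_left)
    show "\<one>\<^bsub>class_ring\<^esub> \<odot>\<^bsub>Q\<^esub> X = X"
      using x by (simp add: X quotient_smult)
  qed (rule class_cring.is_cring Q)+
  then show ?thesis by (simp add: field_algebra_def)
qed

text \<open>The choice of a representative of a coset is harmless since \<open>L\<close> is constant on cosets.\<close>

lemma functional_descends:
  assumes L: "linear_functional A L" and van: "\<And>x. x \<in> I \<Longrightarrow> L x = 0"
  obtains L' where "linear_functional Q L'" "\<And>x. x \<in> carrier A \<Longrightarrow> L' (proj x) = L x"
proof
  let ?L = "\<lambda>X. L (SOME x. x \<in> X)"
  show *: "?L (proj x) = L x" if x: "x \<in> carrier A" for x
  proof -
    have "(SOME y. y \<in> proj x) \<in> proj x" using a_rcos_self[OF x] by (rule someI)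
    then obtain i where "i \<in> I" "(SOME y. y \<in> proj x) = i \<oplus> x" unfolding a_r_coset_def' by blast
    then show ?thesis using L van x a_Hcarr by (simp add: linear_functional_def)
  qed
  show "linear_functional Q ?L"
    unfolding linear_functional_def quotient_carrier
    using L by (auto simp: quotient_add quotient_smult * linear_functional_def)
qed

lemma quotient_finsum:
  assumes "finite S" "g ` S \<subseteq> carrier A"
  shows "proj (\<Oplus>i\<in>S. g i) = (\<Oplus>\<^bsub>Q\<^esub>i\<in>S. proj (g i))"
proof -
  interpret Q: field_algebra Q by (rule quotient_is_algebra)
  show ?thesis using assms
  proof (induction S rule: finite_induct)
    case empty
    then show ?case using quotient_zero_iff[of \<zero>] by simp
  next
    case (insert i S)
    then have "proj (\<Oplus>j\<in>insert i S. g j) = proj (g i \<oplus> (\<Oplus>j\<in>S. g j))"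
      by (subst M.finsum_insert) auto
    also have "\<dots> = proj (g i) \<oplus>\<^bsub>Q\<^esub> proj (\<Oplus>j\<in>S. g j)"
      using insert by (intro quotient_add[symmetric]) (auto intro!: M.finsum_closed)
    also have "\<dots> = (\<Oplus>\<^bsub>Q\<^esub>j\<in>insert i S. proj (g j))"
      using insert by (subst Q.M.finsum_insert) (auto simp: quotient_carrier)
    finally show ?case .
  qed
qed

end

section \<open>Monoid algebras\<close>

lemma lookup_map_times [simp]:
  "Poly_Mapping.lookup (Poly_Mapping.map ((*) (c::'k::field)) p) k = c * Poly_Mapping.lookup p k"
  by (simp add: Poly_Mapping.map.rep_eq when_def)

lemma keys_map_times: "Poly_Mapping.keys (Poly_Mapping.map ((*) (c::'k::field)) p) \<subseteq> Poly_Mapping.keys p"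
  by (auto simp: in_keys_iff)

lemma map_times_single: "Poly_Mapping.map ((*) (c::'k::field)) (Poly_Mapping.single u a) = Poly_Mapping.single u (c * a)"
  by (rule poly_mapping_eqI) (simp add: lookup_single when_def)

lemma map_times_zero [simp]: "Poly_Mapping.map ((*) (c::'k::field)) 0 = 0"
  by (rule poly_mapping_eqI) simp

lemma map_times_add: "Poly_Mapping.map ((*) (c::'k::field)) (p + q) = Poly_Mapping.map ((*) c) p + Poly_Mapping.map ((*) c) q"
  by (rule poly_mapping_eqI) (simp add: lookup_add distrib_left)

lemma poly_mapping_eq_sum_single:
  "p = (\<Sum>u\<in>Poly_Mapping.keys p. Poly_Mapping.single u (Poly_Mapping.lookup p u))"
proof (rule poly_mapping_eqI)
  fix k
  have "(\<Sum>u\<in>Poly_Mapping.keys p. Poly_Mapping.lookup p u when u = k) = Poly_Mapping.lookup p k"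
    by (auto simp: when_def sum.delta in_keys_iff)
  then show "Poly_Mapping.lookup p k = Poly_Mapping.lookup
      (\<Sum>u\<in>Poly_Mapping.keys p. Poly_Mapping.single u (Poly_Mapping.lookup p u)) k"
    by (simp add: lookup_sum lookup_single)
qed

text \<open>With this rule an identity of linear maps on finitely supported functions is reduced to point
masses. Keeping the support inside \<open>C\<close> makes the rule usable for monoid algebras of monoids that
do not fill their type.\<close>

lemma poly_mapping_induct [consumes 1, case_names zero single add]:
  fixes p :: "'b \<Rightarrow>\<^sub>0 'k::comm_monoid_add"
  assumes "Poly_Mapping.keys p \<subseteq> C"
    and "P 0" "\<And>u c. u \<in> C \<Longrightarrow> P (Poly_Mapping.single u c)"
    and add: "\<And>p q. Poly_Mapping.keys p \<subseteq> C \<Longrightarrow> Poly_Mapping.keys q \<subseteq> C \<Longrightarrow> P p \<Longrightarrow> P q \<Longrightarrow> P (p + q)"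
  shows "P p"
proof -
  have "P (\<Sum>u\<in>U. Poly_Mapping.single u (g u)) \<and>
      Poly_Mapping.keys (\<Sum>u\<in>U. Poly_Mapping.single u (g u)) \<subseteq> C"
    if "finite U" "U \<subseteq> C" for U and g :: "'b \<Rightarrow> 'k"
    using that
  proof (induction U rule: finite_induct)
    case (insert u U)
    let ?p = "Poly_Mapping.single u (g u)" and ?q = "\<Sum>u\<in>U. Poly_Mapping.single u (g u)"
    have "Poly_Mapping.keys ?p \<subseteq> C" "Poly_Mapping.keys ?q \<subseteq> C" "P ?p" "P ?q"
      using insert assms(3) by auto
    then have "P (?p + ?q) \<and> Poly_Mapping.keys (?p + ?q) \<subseteq> C"
      using add Poly_Mapping.keys_add[of ?p ?q] by blast
    then show ?case using insert.hyps by simp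
  qed (simp add: assms(2))
  then show ?thesis
    using assms(1) poly_mapping_eq_sum_single[of p] by (metis finite_keys)
qed

context
  fixes M :: "('b, 'c) monoid_scheme" (structure)
begin

text \<open>The multiplication of the monoid algebra. It is bilinear, although its definition as a sum over the supports
hides this; \<open>setsum_keys_plus_distrib\<close> takes care of cancellation in the supports.\<close>

definition conv :: "('b \<Rightarrow>\<^sub>0 'k::field) \<Rightarrow> ('b \<Rightarrow>\<^sub>0 'k) \<Rightarrow> ('b \<Rightarrow>\<^sub>0 'k)" where
  "conv p q = (\<Sum>u\<in>Poly_Mapping.keys p. \<Sum>v\<in>Poly_Mapping.keys q.
     Poly_Mapping.single (u \<otimes> v) (Poly_Mapping.lookup p u * Poly_Mapping.lookup q v))"

lemma conv_add_left: "conv (p + p') q = conv p q + conv p' q"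
  unfolding conv_def
  by (rule setsum_keys_plus_distrib[where f = "\<lambda>u a. \<Sum>v\<in>Poly_Mapping.keys q.
        Poly_Mapping.single (u \<otimes> v) (a * Poly_Mapping.lookup q v)"])
    (simp_all add: single_add distrib_right sum.distrib)

lemma conv_add_right: "conv p (q + q') = conv p q + conv p q'"
proof -
  have "(\<Sum>v\<in>Poly_Mapping.keys (q + q'). Poly_Mapping.single (u \<otimes> v) (a * Poly_Mapping.lookup (q + q') v)) =
      (\<Sum>v\<in>Poly_Mapping.keys q. Poly_Mapping.single (u \<otimes> v) (a * Poly_Mapping.lookup q v)) +
      (\<Sum>v\<in>Poly_Mapping.keys q'. Poly_Mapping.single (u \<otimes> v) (a * Poly_Mapping.lookup q' v))" for u a
    by (rule setsum_keys_plus_distrib[where f = "\<lambda>v b. Poly_Mapping.single (u \<otimes> v) (a * b)"])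
      (simp_all add: single_add distrib_left)
  then show ?thesis unfolding conv_def by (simp add: sum.distrib)
qed

lemma conv_zero [simp]: "conv 0 q = 0" "conv p 0 = 0"
  by (simp_all add: conv_def)

lemma conv_single: "conv (Poly_Mapping.single u a) (Poly_Mapping.single v b) = Poly_Mapping.single (u \<otimes> v) (a * b)"
  by (cases "a = 0"; cases "b = 0") (simp_all add: conv_def)

lemma conv_diff_left: "conv (p - p') q = conv p q - conv p' q"
  using conv_add_left[of "p - p'" p' q] by (simp add: algebra_simps)

end

lemma monoid_algebra_simps [simp]:
  "carrier (monoid_algebra M) = {p. Poly_Mapping.keys p \<subseteq> carrier M}"
  "monoid.mult (monoid_algebra M) = conv M"
  "one (monoid_algebra M) = Poly_Mapping.single \<one>\<^bsub>M\<^esub> 1"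
  "zero (monoid_algebra M) = 0"
  "add (monoid_algebra M) = (+)"
  "module.smult (monoid_algebra M) = (\<lambda>c. Poly_Mapping.map ((*) c))"
  by (auto simp: monoid_algebra_def conv_def fun_eq_iff)

lemma monoid_algebra_is_algebra:
  assumes "comm_monoid M"
  shows "field_algebra (monoid_algebra M :: ('k::field, 'b \<Rightarrow>\<^sub>0 'k) module)"
proof -
  interpret comm_monoid M by fact
  let ?F = "monoid_algebra M :: ('k, 'b \<Rightarrow>\<^sub>0 'k) module"
  have keys_add: "Poly_Mapping.keys (p + q) \<subseteq> carrier M"
    if "Poly_Mapping.keys p \<subseteq> carrier M" "Poly_Mapping.keys q \<subseteq> carrier M" for p q :: "'b \<Rightarrow>\<^sub>0 'k"
    using that Poly_Mapping.keys_add[of p q] by blast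
  have keys_conv: "Poly_Mapping.keys (conv M p q) \<subseteq> carrier M"
    if p: "Poly_Mapping.keys p \<subseteq> carrier M" and q: "Poly_Mapping.keys q \<subseteq> carrier M" for p q :: "'b \<Rightarrow>\<^sub>0 'k"
    using p
  proof (induction rule: poly_mapping_induct)
    case (single u c)
    show ?case using q
      by (induction rule: poly_mapping_induct)
        (simp_all add: conv_single conv_add_right keys_add single)
  qed (simp_all add: conv_add_left keys_add)
  have comm: "conv M p q = conv M q p"
    if p: "Poly_Mapping.keys p \<subseteq> carrier M" and q: "Poly_Mapping.keys q \<subseteq> carrier M" for p q :: "'b \<Rightarrow>\<^sub>0 'k"
    using p
  proof (induction rule: poly_mapping_induct)
    case (single u c)
    show ?case using q
      by (induction rule: poly_mapping_induct)
        (simp_all add: conv_single conv_add_right conv_add_left single m_comm mult.commute)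
  qed (simp_all add: conv_add_left conv_add_right)
  have assoc: "conv M (conv M p q) r = conv M p (conv M q r)"
    if p: "Poly_Mapping.keys p \<subseteq> carrier M" and q: "Poly_Mapping.keys q \<subseteq> carrier M"
      and r: "Poly_Mapping.keys r \<subseteq> carrier M" for p q r :: "'b \<Rightarrow>\<^sub>0 'k"
    using p
  proof (induction rule: poly_mapping_induct)
    case u: (single u a)
    show ?case using q
    proof (induction rule: poly_mapping_induct)
      case v: (single v b)
      show ?case using r
        by (induction rule: poly_mapping_induct)
          (simp_all add: conv_single conv_add_right u v m_assoc mult.assoc)
    qed (simp_all add: conv_add_left conv_add_right)
  qed (simp_all add: conv_add_left)
  have one: "conv M (Poly_Mapping.single \<one>\<^bsub>M\<^esub> 1) p = p"
    if p: "Poly_Mapping.keys p \<subseteq> carrier M" for p :: "'b \<Rightarrow>\<^sub>0 'k"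
    using p
    by (induction rule: poly_mapping_induct) (simp_all add: conv_single conv_add_right)
  have smult_conv: "conv M (Poly_Mapping.map ((*) c) p) q = Poly_Mapping.map ((*) c) (conv M p q)"
    if p: "Poly_Mapping.keys p \<subseteq> carrier M" and q: "Poly_Mapping.keys q \<subseteq> carrier M"
    for c and p q :: "'b \<Rightarrow>\<^sub>0 'k"
    using p
  proof (induction rule: poly_mapping_induct)
    case (single u a)
    show ?case using q
      by (induction rule: poly_mapping_induct)
        (simp_all add: conv_single conv_add_right map_times_single map_times_add mult.assoc)
  qed (simp_all add: conv_add_left map_times_add)
  have ring: "cring ?F"
  proof (rule cringI)
    show "abelian_group ?F"
    proof (rule abelian_groupI)
      fix x assume "x \<in> carrier ?F"
      then show "\<exists>y\<in>carrier ?F. y \<oplus>\<^bsub>?F\<^esub> x = \<zero>\<^bsub>?F\<^esub>"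
        by (intro bexI[of _ "- x"]) (auto simp: in_keys_iff)
    qed (simp_all add: keys_add add_ac)
    show "comm_monoid ?F"
      by (rule comm_monoidI) (auto simp: keys_conv assoc one intro: comm)
  qed (simp add: conv_add_left)
  have "algebra class_ring ?F"
  proof (rule algebraI)
    fix a b and x assume "x \<in> carrier ?F"
    show "(a \<oplus>\<^bsub>class_ring\<^esub> b) \<odot>\<^bsub>?F\<^esub> x = (a \<odot>\<^bsub>?F\<^esub> x) \<oplus>\<^bsub>?F\<^esub> (b \<odot>\<^bsub>?F\<^esub> x)"
      by (auto intro!: poly_mapping_eqI simp: lookup_add distrib_right)
    show "(a \<otimes>\<^bsub>class_ring\<^esub> b) \<odot>\<^bsub>?F\<^esub> x = a \<odot>\<^bsub>?F\<^esub> (b \<odot>\<^bsub>?F\<^esub> x)"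
      by (auto intro!: poly_mapping_eqI simp: mult.assoc)
    show "\<one>\<^bsub>class_ring\<^esub> \<odot>\<^bsub>?F\<^esub> x = x"
      by (auto intro!: poly_mapping_eqI)
    show "a \<odot>\<^bsub>?F\<^esub> x \<in> carrier ?F"
      using \<open>x \<in> carrier ?F\<close> keys_map_times[of a x] by auto
  qed (simp_all add: class_cring.is_cring ring map_times_add smult_conv)
  then show ?thesis by (simp add: field_algebra_def)
qed

definition extend_linearly :: "('b \<Rightarrow> 'k::field) \<Rightarrow> ('b \<Rightarrow>\<^sub>0 'k) \<Rightarrow> 'k" where
  "extend_linearly \<phi> p = (\<Sum>u\<in>Poly_Mapping.keys p. Poly_Mapping.lookup p u * \<phi> u)"

lemma extend_linearly_add: "extend_linearly \<phi> (p + q) = extend_linearly \<phi> p + extend_linearly \<phi> q"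
  unfolding extend_linearly_def
  by (rule setsum_keys_plus_distrib[where f = "\<lambda>u a. a * \<phi> u"]) (simp_all add: distrib_right)

lemma extend_linearly_single [simp]: "extend_linearly \<phi> (Poly_Mapping.single u c) = c * \<phi> u"
  by (cases "c = 0") (simp_all add: extend_linearly_def)

lemma extend_linearly_zero [simp]: "extend_linearly \<phi> 0 = 0"
  by (simp add: extend_linearly_def)

lemma extend_linearly_diff: "extend_linearly \<phi> (p - q) = extend_linearly \<phi> p - extend_linearly \<phi> q"
  using extend_linearly_add[of \<phi> "p - q" q] by simp

lemma extend_linearly_smult:
  "extend_linearly \<phi> (Poly_Mapping.map ((*) c) p) = c * extend_linearly \<phi> p"
  using subset_UNIV[of "Poly_Mapping.keys p"]
  by (induction rule: poly_mapping_induct)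
    (simp_all add: map_times_single map_times_add extend_linearly_add distrib_left mult.assoc)

lemma linear_functional_extend: "linear_functional (monoid_algebra M) (extend_linearly \<phi>)"
  by (simp add: linear_functional_def extend_linearly_add extend_linearly_smult)

section \<open>Tensor powers and the relations of the closure\<close>

definition multilinear :: "nat \<Rightarrow> ('k::field, 'a, 'm) module_scheme \<Rightarrow> ((nat \<Rightarrow> 'a) \<Rightarrow> 'k) \<Rightarrow> bool" where
  "multilinear n A \<phi> \<longleftrightarrow>
     (\<forall>f\<in>{1..n} \<rightarrow>\<^sub>E carrier A. \<forall>i\<in>{1..n}. \<forall>a\<in>carrier A.
        (\<forall>b\<in>carrier A. \<phi> (f(i := a \<oplus>\<^bsub>A\<^esub> b)) = \<phi> (f(i := a)) + \<phi> (f(i := b))) \<and>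
        (\<forall>c. \<phi> (f(i := c \<odot>\<^bsub>A\<^esub> a)) = c * \<phi> (f(i := a))))"

context field_algebra
begin

abbreviation families :: "nat \<Rightarrow> (nat \<Rightarrow> 'a) set" where
  "families n \<equiv> {1..n} \<rightarrow>\<^sub>E carrier A"

abbreviation tensor_prealgebra :: "nat \<Rightarrow> ('k, (nat \<Rightarrow> 'a) \<Rightarrow>\<^sub>0 'k) module" where
  "tensor_prealgebra n \<equiv> monoid_algebra (product_group {1..n} (\<lambda>_. A))"

lemma comm_monoid_families: "comm_monoid (product_group {1..n::nat} (\<lambda>_. A))"
proof (rule comm_monoidI)
  fix x y z assume *: "x \<in> carrier (product_group {1..n} (\<lambda>_. A))" "y \<in> carrier (product_group {1..n} (\<lambda>_. A))"
  then show "x \<otimes>\<^bsub>product_group {1..n} (\<lambda>_. A)\<^esub> y \<in> carrier (product_group {1..n} (\<lambda>_. A))"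
    by (auto simp: PiE_iff)
  show "x \<otimes>\<^bsub>product_group {1..n} (\<lambda>_. A)\<^esub> y = y \<otimes>\<^bsub>product_group {1..n} (\<lambda>_. A)\<^esub> x"
    using * by (auto simp: PiE_iff m_comm intro!: restrict_ext)
  assume z: "z \<in> carrier (product_group {1..n} (\<lambda>_. A))"
  show "x \<otimes>\<^bsub>product_group {1..n} (\<lambda>_. A)\<^esub> y \<otimes>\<^bsub>product_group {1..n} (\<lambda>_. A)\<^esub> z =
      x \<otimes>\<^bsub>product_group {1..n} (\<lambda>_. A)\<^esub> (y \<otimes>\<^bsub>product_group {1..n} (\<lambda>_. A)\<^esub> z)"
    using * z by (auto simp: PiE_iff m_assoc intro!: restrict_ext)
next
  fix x assume "x \<in> carrier (product_group {1..n} (\<lambda>_. A))"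
  then show "\<one>\<^bsub>product_group {1..n} (\<lambda>_. A)\<^esub> \<otimes>\<^bsub>product_group {1..n} (\<lambda>_. A)\<^esub> x = x"
    by (auto simp: PiE_iff extensional_def restrict_def)
qed (auto simp: PiE_iff)

lemma multilinear_relations_subset: "multilinear_relations n A \<subseteq> carrier (tensor_prealgebra n)"
proof -
  have mem: "Poly_Mapping.single (f(i := a)) c \<in> carrier (tensor_prealgebra n)"
    if "f \<in> families n" "i \<in> {1..n}" "a \<in> carrier A" for f i a c
    using that by (auto simp: PiE_iff extensional_def)
  have diff: "p - q \<in> carrier (tensor_prealgebra n)"
    if "p \<in> carrier (tensor_prealgebra n)" "q \<in> carrier (tensor_prealgebra n)" for p q
  proof -
    have "Poly_Mapping.keys (p - q) \<subseteq> Poly_Mapping.keys p \<union> Poly_Mapping.keys q"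
      by (auto simp: in_keys_iff lookup_minus)
    then show ?thesis using that unfolding monoid_algebra_simps by blast
  qed
  show ?thesis
  proof
    fix x assume "x \<in> multilinear_relations n A"
    then consider
      (add) f i a b where "f \<in> families n" "i \<in> {1..n}" "a \<in> carrier A" "b \<in> carrier A"
        "x = Poly_Mapping.single (f(i := a \<oplus> b)) 1 - Poly_Mapping.single (f(i := a)) 1 - Poly_Mapping.single (f(i := b)) 1"
      | (smult) f i c a where "f \<in> families n" "i \<in> {1..n}" "a \<in> carrier A"
        "x = Poly_Mapping.single (f(i := c \<odot> a)) 1 - Poly_Mapping.single (f(i := a)) c"
      unfolding multilinear_relations_def by blast
    then show "x \<in> carrier (tensor_prealgebra n)"
    proof cases
      case add
      show ?thesis unfolding add(5)
        by (intro diff mem add(1-4) a_closed)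
    next
      case smult
      show ?thesis unfolding smult(4)
        by (intro diff mem smult(1-3) smult_closed) simp
    qed
  qed
qed

end

text \<open>Here \<open>F\<close> is the free vector space on families with the product of families extended bilinearly, \<open>J\<close> the ideal of multilinearity relations, and \<open>T\<close> the tensor
power \<open>F / J\<close>.\<close>

locale tensor_power_of_algebra = field_algebra A
  for A :: "('k::field, 'a, 'm) module_scheme" (structure) +
  fixes n :: nat
begin

abbreviation F where "F \<equiv> tensor_prealgebra n"
abbreviation J where "J \<equiv> Idl\<^bsub>F\<^esub> (multilinear_relations n A)"
abbreviation T where "T \<equiv> tensor_power n A"

sublocale F: field_algebra F
  by (rule monoid_algebra_is_algebra[OF comm_monoid_families])

sublocale J: ideal J F
  by (rule F.genideal_ideal[OF multilinear_relations_subset])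

sublocale FJ: algebra_quotient F J ..

lemma T_eq: "FJ.Q = T"
  by (simp add: tensor_power_def Let_def)

sublocale T: field_algebra T
  by (rule FJ.quotient_is_algebra[unfolded T_eq])

lemmas T_carrier = FJ.quotient_carrier[unfolded T_eq]
  and T_add = FJ.quotient_add[unfolded T_eq]
  and T_mult = FJ.quotient_mult[unfolded T_eq]
  and T_smult = FJ.quotient_smult[unfolded T_eq]
  and T_zero_iff = FJ.quotient_zero_iff[unfolded T_eq]

abbreviation pt :: "(nat \<Rightarrow> 'a) \<Rightarrow> ((nat \<Rightarrow> 'a) \<Rightarrow>\<^sub>0 'k) set" where
  "pt \<equiv> pure_tensor n A"

lemma pt_eq: "f \<in> families n \<Longrightarrow> pt f = FJ.proj (Poly_Mapping.single f 1)"
  by (simp add: pure_tensor_def Let_def PiE_restrict)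

lemma single_in_F: "f \<in> families n \<Longrightarrow> Poly_Mapping.single f c \<in> carrier F"
  by simp

lemma pt_closed [simp]: "f \<in> families n \<Longrightarrow> pt f \<in> carrier T"
  unfolding pt_eq T_carrier by (rule imageI[OF single_in_F])

lemma pt_mult:
  assumes f: "f \<in> families n" and g: "g \<in> families n"
  shows "pt f \<otimes>\<^bsub>T\<^esub> pt g = pt (\<lambda>i\<in>{1..n}. f i \<otimes> g i)"
proof -
  have fg: "(\<lambda>i\<in>{1..n}. f i \<otimes> g i) \<in> families n" using f g by (auto simp: PiE_iff)
  show ?thesis
    unfolding pt_eq[OF f] pt_eq[OF g] pt_eq[OF fg] T_mult[OF single_in_F[OF f] single_in_F[OF g]]
    by (simp add: conv_single)
qed

lemma T_one: "\<one>\<^bsub>T\<^esub> = pt (\<lambda>i\<in>{1..n}. \<one>)"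
proof -
  have "(\<lambda>i\<in>{1..n}. \<one>) \<in> families n" by auto
  from pt_eq[OF this] show ?thesis using FJ.quotient_one[unfolded T_eq] by simp
qed

lemma tensor_induct [consumes 1, case_names pt add smult]:
  assumes "X \<in> carrier T"
    and "\<And>f. f \<in> families n \<Longrightarrow> P (pt f)"
    and add: "\<And>X Y. X \<in> carrier T \<Longrightarrow> Y \<in> carrier T \<Longrightarrow> P X \<Longrightarrow> P Y \<Longrightarrow> P (X \<oplus>\<^bsub>T\<^esub> Y)"
    and smult: "\<And>c X. X \<in> carrier T \<Longrightarrow> P X \<Longrightarrow> P (c \<odot>\<^bsub>T\<^esub> X)"
  shows "P X"
proof -
  obtain p where p: "p \<in> carrier F" and X: "X = FJ.proj p"
    using assms(1) unfolding T_carrier by blast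
  have projT: "FJ.proj q \<in> carrier T" if "q \<in> carrier F" for q
    using that unfolding T_carrier by blast
  have single: "P (FJ.proj (Poly_Mapping.single f c))" if f: "f \<in> families n" for f c
  proof -
    have "FJ.proj (Poly_Mapping.single f c) = c \<odot>\<^bsub>T\<^esub> pt f"
      unfolding pt_eq[OF f] T_smult[OF single_in_F[OF f]] by (simp add: map_times_single)
    then show ?thesis using smult[OF pt_closed[OF f] assms(2)[OF f]] by (simp only:)
  qed
  have "Poly_Mapping.keys p \<subseteq> families n" using p by simp
  then have "P (FJ.proj p)"
  proof (induction rule: poly_mapping_induct)
    case zero
    show ?case using single[of "\<lambda>i\<in>{1..n}. \<one>" 0] by auto
  next
    case (single f c)
    then show ?case by (rule \<open>\<And>f c. f \<in> families n \<Longrightarrow> P (FJ.proj (Poly_Mapping.single f c))\<close>)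
  next
    case (add p q)
    then have pq: "p \<in> carrier F" "q \<in> carrier F" by simp_all
    show ?case
      using T_add[OF pq] assms(3)[OF projT[OF pq(1)] projT[OF pq(2)] add.IH(1) add.IH(2)]
      by simp
  qed
  then show ?thesis by (simp add: X)
qed

lemma upd_in_families: "f \<in> families n \<Longrightarrow> i \<in> {1..n} \<Longrightarrow> a \<in> carrier A \<Longrightarrow> f(i := a) \<in> families n"
  by (auto simp: PiE_iff extensional_def)

lemma pt_upd_add:
  assumes f: "f \<in> families n" and i: "i \<in> {1..n}" and a: "a \<in> carrier A" and b: "b \<in> carrier A"
  shows "pt (f(i := a \<oplus> b)) = pt (f(i := a)) \<oplus>\<^bsub>T\<^esub> pt (f(i := b))"
proof -
  let ?s = "\<lambda>a. Poly_Mapping.single (f(i := a)) (1::'k)"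
  have mem: "?s a \<in> carrier F" if "a \<in> carrier A" for a
    using upd_in_families[OF f i that] by simp
  let ?r = "?s (a \<oplus> b) - ?s a - ?s b"
  have "?r \<in> multilinear_relations n A"
    unfolding multilinear_relations_def using f i a b by blast
  then have r: "?r \<in> J" using F.genideal_self[OF multilinear_relations_subset] by blast
  then have rF: "?r \<in> carrier F" by (rule J.a_Hcarr)
  have "pt (f(i := a \<oplus> b)) = FJ.proj (?s (a \<oplus> b))"
    by (rule pt_eq[OF upd_in_families[OF f i a_closed[OF a b]]])
  also have "\<dots> = FJ.proj (?r \<oplus>\<^bsub>F\<^esub> (?s a \<oplus>\<^bsub>F\<^esub> ?s b))"
    by simp
  also have "\<dots> = FJ.proj ?r \<oplus>\<^bsub>T\<^esub> FJ.proj (?s a \<oplus>\<^bsub>F\<^esub> ?s b)"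
    by (rule T_add[symmetric, OF rF]) (rule F.a_closed[OF mem[OF a] mem[OF b]])
  also have "FJ.proj ?r = \<zero>\<^bsub>T\<^esub>" using T_zero_iff[OF rF] r by blast
  also have "FJ.proj (?s a \<oplus>\<^bsub>F\<^esub> ?s b) = pt (f(i := a)) \<oplus>\<^bsub>T\<^esub> pt (f(i := b))"
    unfolding pt_eq[OF upd_in_families[OF f i a]] pt_eq[OF upd_in_families[OF f i b]]
    by (rule T_add[symmetric, OF mem[OF a] mem[OF b]])
  also have "\<zero>\<^bsub>T\<^esub> \<oplus>\<^bsub>T\<^esub> (pt (f(i := a)) \<oplus>\<^bsub>T\<^esub> pt (f(i := b))) = pt (f(i := a)) \<oplus>\<^bsub>T\<^esub> pt (f(i := b))"
    by (intro T.M.l_zero T.M.a_closed pt_closed upd_in_families f i a b)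
  finally show ?thesis .
qed

lemma pt_upd_smult:
  assumes f: "f \<in> families n" and i: "i \<in> {1..n}" and a: "a \<in> carrier A"
  shows "pt (f(i := c \<odot> a)) = c \<odot>\<^bsub>T\<^esub> pt (f(i := a))"
proof -
  have mem: "Poly_Mapping.single (f(i := a)) d \<in> carrier F" if "a \<in> carrier A" for a d
    using upd_in_families[OF f i that] by simp
  let ?r = "Poly_Mapping.single (f(i := c \<odot> a)) 1 - Poly_Mapping.single (f(i := a)) c"
  have "?r \<in> multilinear_relations n A"
    unfolding multilinear_relations_def using f i a by blast
  then have r: "?r \<in> J" using F.genideal_self[OF multilinear_relations_subset] by blast
  then have rF: "?r \<in> carrier F" by (rule J.a_Hcarr)
  have ca: "c \<odot> a \<in> carrier A" using a by simp
  have "pt (f(i := c \<odot> a)) = FJ.proj (?r \<oplus>\<^bsub>F\<^esub> Poly_Mapping.single (f(i := a)) c)"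
    unfolding pt_eq[OF upd_in_families[OF f i ca]] by simp
  also have "\<dots> = FJ.proj ?r \<oplus>\<^bsub>T\<^esub> FJ.proj (Poly_Mapping.single (f(i := a)) c)"
    by (rule T_add[symmetric, OF rF mem[OF a]])
  also have "FJ.proj ?r = \<zero>\<^bsub>T\<^esub>" using T_zero_iff[OF rF] r by blast
  also have "FJ.proj (Poly_Mapping.single (f(i := a)) c) = c \<odot>\<^bsub>T\<^esub> pt (f(i := a))"
    unfolding pt_eq[OF upd_in_families[OF f i a]] T_smult[OF mem[OF a]] by (simp add: map_times_single)
  also have "\<zero>\<^bsub>T\<^esub> \<oplus>\<^bsub>T\<^esub> (c \<odot>\<^bsub>T\<^esub> pt (f(i := a))) = c \<odot>\<^bsub>T\<^esub> pt (f(i := a))"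
    by (intro T.M.l_zero T.smult_closed pt_closed upd_in_families f i a) simp
  finally show ?thesis .
qed

text \<open>The universal property of the tensor power. The linear extension of \<open>\<phi>\<close> kills the relations, and also
their multiples, because a basis element times a relation in position \<open>i\<close> is again a relation in position \<open>i\<close>.\<close>

lemma functional_on_tensor_power:
  assumes \<phi>: "multilinear n A \<phi>"
  obtains L where "linear_functional T L" "\<And>f. f \<in> families n \<Longrightarrow> L (pt f) = \<phi> f"
proof -
  let ?L = "extend_linearly \<phi>"
  let ?M = "product_group {1..n} (\<lambda>_. A)"
  have lin: "linear_functional F ?L" by (rule linear_functional_extend)
  have upd: "(f(i := a)) \<otimes>\<^bsub>?M\<^esub> g = (f \<otimes>\<^bsub>?M\<^esub> g)(i := a \<otimes> g i)" if "i \<in> {1..n}" for f g i a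
    using that by (auto simp: fun_eq_iff restrict_def)
  have fg: "f \<otimes>\<^bsub>?M\<^esub> g \<in> families n" if "f \<in> families n" "g \<in> families n" for f g
    using that by (auto simp: PiE_iff)
  have van: "?L (x \<otimes>\<^bsub>F\<^esub> y) = 0" if x: "x \<in> multilinear_relations n A" and y: "y \<in> carrier F" for x y
  proof -
    have "Poly_Mapping.keys y \<subseteq> families n" using y by simp
    then have "?L (conv ?M x y) = 0"
    proof (induction rule: poly_mapping_induct)
      case (single g d)
      from x consider
        (add) f i a b where "f \<in> families n" "i \<in> {1..n}" "a \<in> carrier A" "b \<in> carrier A"
          "x = Poly_Mapping.single (f(i := a \<oplus> b)) 1 - Poly_Mapping.single (f(i := a)) 1 - Poly_Mapping.single (f(i := b)) 1"
        | (smult) f i c a where "f \<in> families n" "i \<in> {1..n}" "a \<in> carrier A"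
          "x = Poly_Mapping.single (f(i := c \<odot> a)) 1 - Poly_Mapping.single (f(i := a)) c"
        unfolding multilinear_relations_def by blast
      then show ?case
      proof cases
        case add
        have gi: "g i \<in> carrier A" using single add(2) by auto
        have "(a \<oplus> b) \<otimes> g i = a \<otimes> g i \<oplus> b \<otimes> g i" using add gi by (simp add: l_distr)
        moreover have "\<phi> ((f \<otimes>\<^bsub>?M\<^esub> g)(i := a \<otimes> g i \<oplus> b \<otimes> g i)) =
            \<phi> ((f \<otimes>\<^bsub>?M\<^esub> g)(i := a \<otimes> g i)) + \<phi> ((f \<otimes>\<^bsub>?M\<^esub> g)(i := b \<otimes> g i))"
          using \<phi> fg[OF add(1) single] add(2-4) gi unfolding multilinear_def by blast
        ultimately show ?thesis
          unfolding add(5) conv_diff_left conv_single upd[OF add(2)] extend_linearly_diff extend_linearly_single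
          by (simp add: algebra_simps)
      next
        case smult
        have gi: "g i \<in> carrier A" using single smult(2) by auto
        have "(c \<odot> a) \<otimes> g i = c \<odot> (a \<otimes> g i)" using smult gi by (simp add: smult_assoc2)
        moreover have "\<phi> ((f \<otimes>\<^bsub>?M\<^esub> g)(i := c \<odot> (a \<otimes> g i))) = c * \<phi> ((f \<otimes>\<^bsub>?M\<^esub> g)(i := a \<otimes> g i))"
          using \<phi> fg[OF smult(1) single] smult(2,3) gi unfolding multilinear_def by blast
        ultimately show ?thesis
          unfolding smult(4) conv_diff_left conv_single upd[OF smult(2)] extend_linearly_diff extend_linearly_single
          by (simp add: algebra_simps)
      qed
    qed (simp_all add: conv_add_right extend_linearly_add)
    then show ?thesis by simp
  qed
  have "?L x = 0" if "x \<in> J" for x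
    by (rule F.functional_vanishes_on_genideal[OF lin multilinear_relations_subset van that])
  then obtain L' where L': "linear_functional FJ.Q L'" "\<And>x. x \<in> carrier F \<Longrightarrow> L' (FJ.proj x) = ?L x"
    using FJ.functional_descends[OF lin] by blast
  show thesis
  proof (rule that)
    show "linear_functional T L'" using L'(1) unfolding T_eq .
    show "L' (pt f) = \<phi> f" if "f \<in> families n" for f
      unfolding pt_eq[OF that] L'(2)[OF single_in_F[OF that]] by simp
  qed
qed

end

context field_algebra
begin

lemma fin_dim_if_spanned:
  assumes B: "finite B" "B \<subseteq> carrier A"
    and span: "\<And>N. submodule class_ring N A \<Longrightarrow> B \<subseteq> N \<Longrightarrow> carrier A \<subseteq> N"
  shows "vectorspace.fin_dim class_ring A"
proof -
  interpret V: vectorspace class_ring A by (rule is_vectorspace)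
  have "carrier A \<subseteq> span B"
    by (rule span[OF span_is_submodule[OF B(2)] in_own_span[OF B(2)]])
  then have "span B = carrier A" using span_is_subset2[OF B(2)] by blast
  then show ?thesis unfolding V.fin_dim_def using B by blast
qed

lemma fin_dim_quotient:
  assumes fd: "vectorspace.fin_dim class_ring A" and I: "ideal I A"
  shows "vectorspace.fin_dim class_ring (quotient_algebra A I)"
proof -
  interpret I: ideal I A by fact
  interpret algebra_quotient A I ..
  interpret V: vectorspace class_ring A by (rule is_vectorspace)
  interpret Q: field_algebra Q by (rule quotient_is_algebra)
  obtain B where B: "finite B" "B \<subseteq> carrier A" "span B = carrier A"
    using fd unfolding V.fin_dim_def by blast
  show ?thesis
  proof (rule Q.fin_dim_if_spanned)
    show "finite (proj ` B)" "proj ` B \<subseteq> carrier Q" using B quotient_carrier by auto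
  next
    fix N assume N: "submodule class_ring N Q" and BN: "proj ` B \<subseteq> N"
    interpret N: submodule class_ring N Q by fact
    let ?N = "{x \<in> carrier A. proj x \<in> N}"
    have "submodule class_ring ?N A"
    proof
      fix x y assume "x \<in> ?N" "y \<in> ?N"
      then show "x \<oplus> y \<in> ?N" using N.m_closed[of "proj x" "proj y"] by (simp add: quotient_add)
    next
      show "\<zero> \<in> ?N" using N.zero_closed quotient_zero_iff[of \<zero>] I.zero_closed by simp
    next
      fix c x assume "x \<in> ?N"
      then show "c \<odot> x \<in> ?N" using N.smult_closed[of c "proj x"] by (simp add: quotient_smult)
    qed auto
    then have "span B \<subseteq> ?N" using B BN by (intro span_is_subset) auto
    then show "carrier Q \<subseteq> N" using B(3) quotient_carrier by auto
  qed
qed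

end

context tensor_power_of_algebra
begin

text \<open>The pure tensors with factors in a finite spanning set \<open>X\<close> span: in an arbitrary pure tensor,
the factors outside \<open>X\<close> are expanded one after the other. The induction is on the set \<open>D\<close> of positions where such
factors are permitted.\<close>

lemma fin_dim_tensor_power:
  assumes fd: "vectorspace.fin_dim class_ring A"
  shows "vectorspace.fin_dim class_ring T"
proof -
  interpret V: vectorspace class_ring A by (rule is_vectorspace)
  obtain X where X: "finite X" "X \<subseteq> carrier A" "span X = carrier A"
    using fd unfolding V.fin_dim_def by blast
  let ?B = "pt ` ({1..n} \<rightarrow>\<^sub>E X)"
  have XF: "{1..n} \<rightarrow>\<^sub>E X \<subseteq> families n" using X(2) by (rule PiE_mono)
  show ?thesis
  proof (rule T.fin_dim_if_spanned)
    show "finite ?B" using X(1) by (intro finite_imageI finite_PiE) auto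
    show "?B \<subseteq> carrier T" using XF pt_closed by blast
  next
    fix N assume N: "submodule class_ring N T" and BN: "?B \<subseteq> N"
    interpret N: submodule class_ring N T by fact
    have "pt f \<in> N" if "finite D" "f \<in> families n" "\<forall>i\<in>{1..n} - D. f i \<in> X" for D f
      using that
    proof (induction D arbitrary: f rule: finite_induct)
      case empty
      then have "f \<in> {1..n} \<rightarrow>\<^sub>E X" by (auto simp: PiE_iff)
      then show ?case using BN by blast
    next
      case (insert i D)
      note f = insert.prems(1)
      show ?case
      proof (cases "i \<in> {1..n}")
        case False
        then show ?thesis using insert by auto
      next
        case i: True
        have "f i \<in> carrier A" using f i by (rule PiE_mem)
        then have "f i \<in> span X" unfolding X(3) .
        then obtain c where c: "f i = lincomb c X"
          unfolding finite_span[OF X(1,2)] by blast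
        have "pt (f(i := (\<Oplus>x\<in>Y. c x \<odot> x))) \<in> N" if "finite Y" "Y \<subseteq> X" for Y
          using that
        proof (induction Y rule: finite_induct)
          case empty
          have "pt (f(i := 0 \<odot> \<zero>)) = 0 \<odot>\<^bsub>T\<^esub> pt (f(i := \<zero>))"
            by (rule pt_upd_smult[OF f i]) simp
          also have "\<dots> = \<zero>\<^bsub>T\<^esub>"
            using T.lmult_0[OF pt_closed[OF upd_in_families[OF f i zero_closed]]] by simp
          also have "0 \<odot> \<zero> = (\<Oplus>x\<in>{}. c x \<odot> x)" using lmult_0[of \<zero>] by simp
          finally show ?case using N.zero_closed by simp
        next
          case (insert x Y)
          have cl: "x \<in> carrier A" "c x \<odot> x \<in> carrier A" "(\<Oplus>x\<in>Y. c x \<odot> x) \<in> carrier A"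
            using insert X(2) by (auto intro!: M.finsum_closed)
          have sum: "(\<Oplus>y\<in>insert x Y. c y \<odot> y) = c x \<odot> x \<oplus> (\<Oplus>x\<in>Y. c x \<odot> x)"
            using insert X(2) by (intro M.finsum_insert) auto
          have "f(i := x) \<in> families n" by (rule upd_in_families[OF f i cl(1)])
          moreover have "\<forall>k\<in>{1..n} - D. (f(i := x)) k \<in> X"
            using insert.prems \<open>\<forall>k\<in>{1..n} - Set.insert i D. f k \<in> X\<close> by auto
          ultimately have "pt (f(i := x)) \<in> N" by (rule \<open>\<And>f. f \<in> families n \<Longrightarrow> \<forall>i\<in>{1..n} - D. f i \<in> X \<Longrightarrow> pt f \<in> N\<close>)
          then have "pt (f(i := c x \<odot> x)) \<in> N"
            unfolding pt_upd_smult[OF f i cl(1)] by (intro N.smult_closed) simp_all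
          moreover have "pt (f(i := (\<Oplus>x\<in>Y. c x \<odot> x))) \<in> N"
            using insert.prems by (intro insert.IH) blast
          ultimately show ?case
            unfolding sum pt_upd_add[OF f i cl(2,3)] by (rule N.m_closed)
        qed
        from this[OF X(1) subset_refl] have "pt (f(i := f i)) \<in> N"
          unfolding c lincomb_def .
        then show ?thesis by simp
      qed
    qed
    from this[of "{1..n}"] have ptN: "pt f \<in> N" if "f \<in> families n" for f
      using that by simp
    show "carrier T \<subseteq> N"
    proof
      fix Y assume "Y \<in> carrier T"
      then show "Y \<in> N"
      proof (induction rule: tensor_induct)
        case (pt f)
        then show ?case by (rule ptN)
      next
        case (add X Y)
        then show ?case by (intro N.m_closed)
      next
        case (smult c X)
        then show ?case by (intro N.smult_closed) simp_all
      qed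
    qed
  qed
qed

lemma tensor_factor_eq: "tensor_factor n A i a = pt (\<lambda>j\<in>{1..n}. if j = i then a else \<one>)"
  by (simp add: tensor_factor_def pure_tensor_def)

lemma finprod_tensor_factor:
  assumes a: "a \<in> carrier A" and S: "S \<subseteq> {1..n}"
  shows "(\<Otimes>\<^bsub>T\<^esub>i\<in>S. tensor_factor n A i a) = pt (\<lambda>j\<in>{1..n}. if j \<in> S then a else \<one>)"
proof -
  have "finite S" using S by (rule finite_subset) simp
  then show ?thesis using S
  proof (induction S rule: finite_induct)
    case empty
    then show ?case by (simp only: T.finprod_empty T_one empty_iff if_False)
  next
    case (insert i S)
    have fam: "(\<lambda>j\<in>{1..n}. if j \<in> U then a else \<one>) \<in> families n" for U using a by auto
    have fam1: "(\<lambda>j\<in>{1..n}. if j = k then a else \<one>) \<in> families n" for k using a by auto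
    have tf: "tensor_factor n A k a \<in> carrier T" for k
      unfolding tensor_factor_eq by (rule pt_closed[OF fam1])
    have "(\<Otimes>\<^bsub>T\<^esub>k\<in>Set.insert i S. tensor_factor n A k a) =
        tensor_factor n A i a \<otimes>\<^bsub>T\<^esub> (\<Otimes>\<^bsub>T\<^esub>k\<in>S. tensor_factor n A k a)"
      using insert.hyps tf by (intro T.finprod_insert) auto
    also have "\<dots> = pt (\<lambda>j\<in>{1..n}. if j = i then a else \<one>) \<otimes>\<^bsub>T\<^esub> pt (\<lambda>j\<in>{1..n}. if j \<in> S then a else \<one>)"
      proof -
      have IH: "(\<Otimes>\<^bsub>T\<^esub>k\<in>S. tensor_factor n A k a) = pt (\<lambda>j\<in>{1..n}. if j \<in> S then a else \<one>)"
        using insert.prems by (intro insert.IH) blast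
      show ?thesis unfolding IH unfolding tensor_factor_eq ..
    qed
    also have "\<dots> = pt (\<lambda>j\<in>{1..n}. (\<lambda>j\<in>{1..n}. if j = i then a else \<one>) j \<otimes> (\<lambda>j\<in>{1..n}. if j \<in> S then a else \<one>) j)"
      by (rule pt_mult[OF fam1 fam])
    also have "(\<lambda>j\<in>{1..n}. (\<lambda>j\<in>{1..n}. if j = i then a else \<one>) j \<otimes> (\<lambda>j\<in>{1..n}. if j \<in> S then a else \<one>) j) =
        (\<lambda>j\<in>{1..n}. if j \<in> Set.insert i S then a else \<one>)"
      using a insert.hyps by (intro restrict_ext) auto
    finally show ?case .
  qed
qed

abbreviation elementary :: "nat \<Rightarrow> 'a \<Rightarrow> ((nat \<Rightarrow> 'a) \<Rightarrow>\<^sub>0 'k) set" where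
  "elementary j a \<equiv> \<Oplus>\<^bsub>T\<^esub>S\<in>{S. S \<subseteq> {1..n} \<and> card S = j}. \<Otimes>\<^bsub>T\<^esub>i\<in>S. tensor_factor n A i a"

lemma ones_closed: "a \<in> carrier A \<Longrightarrow> pt (\<lambda>j\<in>{1..n}. if j \<in> S then a else \<one>) \<in> carrier T"
  by (rule pt_closed) auto

lemma elementary_eq:
  assumes a: "a \<in> carrier A"
  shows "elementary j a = (\<Oplus>\<^bsub>T\<^esub>S\<in>{S. S \<subseteq> {1..n} \<and> card S = j}. pt (\<lambda>i\<in>{1..n}. if i \<in> S then a else \<one>))"
  by (rule T.M.finsum_cong') (use a finprod_tensor_factor ones_closed in auto)

lemma elementary_closed: "a \<in> carrier A \<Longrightarrow> elementary j a \<in> carrier T"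
  unfolding elementary_eq by (intro T.M.finsum_closed) (use ones_closed in auto)

text \<open>The product of the generator for \<open>a\<close> and \<open>j\<close> with the pure tensor of \<open>f\<close> is \<open>s j a\<close> times this tensor minus the sum of
the tensors in which \<open>j\<close> of the factors are multiplied by \<open>a\<close>; pure tensors span, so \<open>sym\<close> is the required identity.\<close>

lemma functional_vanishes_on_closure_relations:
  assumes L: "linear_functional T L" and Lpt: "\<And>f. f \<in> families n \<Longrightarrow> L (pt f) = \<phi> f"
    and sym: "\<And>a j f. a \<in> carrier A \<Longrightarrow> j \<in> {1..n} \<Longrightarrow> f \<in> families n \<Longrightarrow>
      (\<Sum>S | S \<subseteq> {1..n} \<and> card S = j. \<phi> (\<lambda>i\<in>{1..n}. if i \<in> S then a \<otimes> f i else f i)) = s j a * \<phi> f"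
    and x: "x \<in> Idl\<^bsub>T\<^esub> {(s j a \<odot>\<^bsub>T\<^esub> \<one>\<^bsub>T\<^esub>) \<ominus>\<^bsub>T\<^esub> elementary j a | a j. a \<in> carrier A \<and> j \<in> {1..n}}"
  shows "L x = 0"
proof (rule T.functional_vanishes_on_genideal[OF L _ _ x])
  have cl: "s j a \<odot>\<^bsub>T\<^esub> \<one>\<^bsub>T\<^esub> \<in> carrier T" for j a by (rule T.smult_closed) auto
  show "{(s j a \<odot>\<^bsub>T\<^esub> \<one>\<^bsub>T\<^esub>) \<ominus>\<^bsub>T\<^esub> elementary j a | a j. a \<in> carrier A \<and> j \<in> {1..n}} \<subseteq> carrier T"
    using cl elementary_closed by (auto intro!: T.minus_closed)
  have add: "L (X \<oplus>\<^bsub>T\<^esub> Y) = L X + L Y" if "X \<in> carrier T" "Y \<in> carrier T" for X Y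
    using L that unfolding linear_functional_def by blast
  have smult: "L (c \<odot>\<^bsub>T\<^esub> X) = c * L X" if "X \<in> carrier T" for c X
    using L that unfolding linear_functional_def by blast
  have minus: "L (X \<ominus>\<^bsub>T\<^esub> Y) = L X - L Y" if "X \<in> carrier T" "Y \<in> carrier T" for X Y
  proof -
    have "X = (X \<ominus>\<^bsub>T\<^esub> Y) \<oplus>\<^bsub>T\<^esub> Y"
      using that by (simp add: T.minus_eq T.a_assoc T.l_neg)
    then have "L X = L (X \<ominus>\<^bsub>T\<^esub> Y) + L Y" using add[of "X \<ominus>\<^bsub>T\<^esub> Y" Y] that by (metis T.minus_closed)
    then show ?thesis by simp
  qed
  fix x y assume "x \<in> {(s j a \<odot>\<^bsub>T\<^esub> \<one>\<^bsub>T\<^esub>) \<ominus>\<^bsub>T\<^esub> elementary j a | a j. a \<in> carrier A \<and> j \<in> {1..n}}"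
    and y: "y \<in> carrier T"
  then obtain a j where a: "a \<in> carrier A" and j: "j \<in> {1..n}"
    and xe: "x = (s j a \<odot>\<^bsub>T\<^esub> \<one>\<^bsub>T\<^esub>) \<ominus>\<^bsub>T\<^esub> elementary j a" by blast
  have xT: "x \<in> carrier T" unfolding xe by (intro T.minus_closed cl elementary_closed a)
  show "L (x \<otimes>\<^bsub>T\<^esub> y) = 0" using y
  proof (induction rule: tensor_induct)
    case (pt f)
    let ?P = "{S. S \<subseteq> {1..n} \<and> card S = j}"
    let ?o = "\<lambda>S. (\<lambda>i\<in>{1..n}. if i \<in> S then a else \<one>)"
    have fin: "finite ?P" by simp
    have fT: "pt f \<in> carrier T" using pt by (rule pt_closed)
    have oF: "?o S \<in> families n" for S using a by auto
    have afF: "(\<lambda>i\<in>{1..n}. if i \<in> S then a \<otimes> f i else f i) \<in> families n" for S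
      using a pt by (auto simp: PiE_iff)
    have "x \<otimes>\<^bsub>T\<^esub> pt f = ((s j a \<odot>\<^bsub>T\<^esub> \<one>\<^bsub>T\<^esub>) \<otimes>\<^bsub>T\<^esub> pt f) \<ominus>\<^bsub>T\<^esub> (elementary j a \<otimes>\<^bsub>T\<^esub> pt f)"
      unfolding xe T.minus_eq using cl elementary_closed[OF a] fT
      by (simp add: T.l_distr T.l_minus)
    also have "(s j a \<odot>\<^bsub>T\<^esub> \<one>\<^bsub>T\<^esub>) \<otimes>\<^bsub>T\<^esub> pt f = s j a \<odot>\<^bsub>T\<^esub> pt f"
      using fT T.smult_assoc2[of "s j a" "\<one>\<^bsub>T\<^esub>" "pt f"] by simp
    also have "elementary j a \<otimes>\<^bsub>T\<^esub> pt f = (\<Oplus>\<^bsub>T\<^esub>S\<in>?P. pt (?o S) \<otimes>\<^bsub>T\<^esub> pt f)"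
      unfolding elementary_eq[OF a]
      by (rule T.finsum_ldistr[OF fin fT]) (use pt_closed[OF oF] in auto)
    also have "\<dots> = (\<Oplus>\<^bsub>T\<^esub>S\<in>?P. pt (\<lambda>i\<in>{1..n}. if i \<in> S then a \<otimes> f i else f i))"
    proof (rule T.M.finsum_cong'[OF refl])
      show "(\<lambda>S. pt (\<lambda>i\<in>{1..n}. if i \<in> S then a \<otimes> f i else f i)) \<in> ?P \<rightarrow> carrier T"
        using pt_closed[OF afF] by blast
      fix S
      have "(\<lambda>i\<in>{1..n}. ?o S i \<otimes> f i) = (\<lambda>i\<in>{1..n}. if i \<in> S then a \<otimes> f i else f i)"
        using pt by (intro restrict_ext) (auto simp: PiE_iff)
      then show "pt (?o S) \<otimes>\<^bsub>T\<^esub> pt f = pt (\<lambda>i\<in>{1..n}. if i \<in> S then a \<otimes> f i else f i)"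
        unfolding pt_mult[OF oF pt] by (rule arg_cong)
    qed
    finally have "L (x \<otimes>\<^bsub>T\<^esub> pt f) = L (s j a \<odot>\<^bsub>T\<^esub> pt f) -
        L (\<Oplus>\<^bsub>T\<^esub>S\<in>?P. pt (\<lambda>i\<in>{1..n}. if i \<in> S then a \<otimes> f i else f i))"
      using fT pt_closed[OF afF] by (simp only:) (intro minus T.smult_closed T.M.finsum_closed; force)
    also have "L (s j a \<odot>\<^bsub>T\<^esub> pt f) = s j a * \<phi> f" using smult[OF fT] Lpt[OF pt] by (simp only:)
    also have "L (\<Oplus>\<^bsub>T\<^esub>S\<in>?P. pt (\<lambda>i\<in>{1..n}. if i \<in> S then a \<otimes> f i else f i)) =
        (\<Sum>S\<in>?P. L (pt (\<lambda>i\<in>{1..n}. if i \<in> S then a \<otimes> f i else f i)))"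
      by (rule linear_functional_finsum[OF T.is_module L fin]) (use pt_closed[OF afF] in blast)
    also have "\<dots> = s j a * \<phi> f"
      unfolding Lpt[OF afF] by (rule sym[OF a j pt])
    finally show ?case by simp
  next
    case (add X Y)
    then show ?case using xT \<open>\<And>X Y. X \<in> carrier T \<Longrightarrow> Y \<in> carrier T \<Longrightarrow> L (X \<oplus>\<^bsub>T\<^esub> Y) = L X + L Y\<close>[of "x \<otimes>\<^bsub>T\<^esub> X" "x \<otimes>\<^bsub>T\<^esub> Y"]
      by (simp add: T.r_distr)
  next
    case (smult c X)
    have "x \<otimes>\<^bsub>T\<^esub> (c \<odot>\<^bsub>T\<^esub> X) = c \<odot>\<^bsub>T\<^esub> (x \<otimes>\<^bsub>T\<^esub> X)"
      using T.smult_assoc2[of c X x] smult.hyps xT by (simp add: T.m_comm)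
    then show ?case using smult \<open>\<And>c X. X \<in> carrier T \<Longrightarrow> L (c \<odot>\<^bsub>T\<^esub> X) = c * L X\<close>[of "x \<otimes>\<^bsub>T\<^esub> X" c] xT
      by simp
  qed
qed

end

section \<open>Truncated polynomials\<close>

text \<open>The form in which \<open>R\<^sub>n\<close> is used: a basis \<open>x 0, \<dots>, x (n - 1)\<close> with coordinate functionals for which
multiplication is that of dual numbers in several variables, the role of the unit
being played by \<open>x 0\<close>.\<close>

locale square_zero_extension = field_algebra A
  for A :: "('k::field, 'a, 'm) module_scheme" (structure) +
  fixes n :: nat and x :: "nat \<Rightarrow> 'a" and coord :: "nat \<Rightarrow> 'a \<Rightarrow> 'k"
  assumes n_pos: "0 < n"
    and x_closed: "b < n \<Longrightarrow> x b \<in> carrier A"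
    and coord_linear: "linear_functional A (coord b)"
    and coord_x: "b < n \<Longrightarrow> b' < n \<Longrightarrow> coord b (x b') = (if b = b' then 1 else 0)"
    and expansion: "a \<in> carrier A \<Longrightarrow> a = (\<Oplus>b\<in>{..<n}. coord b a \<odot> x b)"
    and coord_mult_0: "a \<in> carrier A \<Longrightarrow> y \<in> carrier A \<Longrightarrow> coord 0 (a \<otimes> y) = coord 0 a * coord 0 y"
    and coord_mult: "a \<in> carrier A \<Longrightarrow> y \<in> carrier A \<Longrightarrow> b \<noteq> 0 \<Longrightarrow>
      coord b (a \<otimes> y) = coord 0 a * coord b y + coord b a * coord 0 y"

definition exponents :: "nat set \<Rightarrow> (nat \<Rightarrow>\<^sub>0 nat) monoid" where
  "exponents V = \<lparr>carrier = {m. Poly_Mapping.keys m \<subseteq> V}, monoid.mult = (+), one = 0\<rparr>"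

lemma comm_monoid_exponents: "comm_monoid (exponents V)"
proof (rule comm_monoidI)
  fix x y assume "x \<in> carrier (exponents V)" "y \<in> carrier (exponents V)"
  then show "x \<otimes>\<^bsub>exponents V\<^esub> y \<in> carrier (exponents V)"
    using Poly_Mapping.keys_add[of x y] by (auto simp: exponents_def)
qed (simp_all add: exponents_def add_ac)

lemma conv_exponents: "conv (exponents V) p q = p * (q :: (nat \<Rightarrow>\<^sub>0 nat) \<Rightarrow>\<^sub>0 'k::field)"
  using subset_UNIV[of "Poly_Mapping.keys p"]
proof (induction rule: poly_mapping_induct)
  case (single u c)
  show ?case using subset_UNIV[of "Poly_Mapping.keys q"]
    by (induction rule: poly_mapping_induct)
      (simp_all add: conv_single conv_add_right mult_single distrib_left, simp add: exponents_def)
qed (simp_all add: conv_add_left distrib_right)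

text \<open>Polynomials in the variables from \<open>V\<close> are the monoid algebra of exponent vectors supported in \<open>V\<close>, so
that the facts on monoid algebras apply.\<close>

lemma polynomial_algebra_eq: "polynomial_algebra V = monoid_algebra (exponents V)"
proof -
  have "((*) :: ((nat \<Rightarrow>\<^sub>0 nat) \<Rightarrow>\<^sub>0 'k::field) \<Rightarrow> _) =
      (\<lambda>p q. \<Sum>u\<in>Poly_Mapping.keys p. \<Sum>v\<in>Poly_Mapping.keys q.
        Poly_Mapping.single (u \<otimes>\<^bsub>exponents V\<^esub> v) (Poly_Mapping.lookup p u * Poly_Mapping.lookup q v))"
    by (intro ext) (simp only: conv_exponents[of V, symmetric] conv_def)
  then show ?thesis
    unfolding polynomial_algebra_def monoid_algebra_def
    by (auto simp: exponents_def)
qed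

text \<open>The exponent vectors of degree at most one: index \<open>0\<close> stands for the constant monomial and
\<open>b > 0\<close> for the variable number \<open>b\<close>, in agreement with the numbering of the basis of \<open>R\<^sub>n\<close>.\<close>

definition low_exponent :: "nat \<Rightarrow> (nat \<Rightarrow>\<^sub>0 nat)" where
  "low_exponent b = (if b = 0 then 0 else Poly_Mapping.single b 1)"

lemma low_exponent_inj: "low_exponent b = low_exponent b' \<longleftrightarrow> b = b'"
proof
  assume "low_exponent b = low_exponent b'"
  then have "Poly_Mapping.lookup (low_exponent b) k = Poly_Mapping.lookup (low_exponent b') k" for k by simp
  from this[of b] this[of b'] show "b = b'"
    by (auto simp: low_exponent_def lookup_single when_def split: if_splits)
qed simp

lemma add_eq_0_exponents: "k + l = (0 :: nat \<Rightarrow>\<^sub>0 nat) \<longleftrightarrow> k = 0 \<and> l = 0"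
  by (auto simp: poly_mapping_eq_iff fun_eq_iff lookup_add)

lemma add_eq_single_exponents:
  assumes "k + l = Poly_Mapping.single b (1::nat)"
  shows "k = 0 \<or> l = 0"
proof (rule ccontr)
  assume "\<not> ?thesis"
  then obtain i j where "Poly_Mapping.lookup k i \<noteq> 0" "Poly_Mapping.lookup l j \<noteq> 0"
    by (metis poly_mapping_eqI lookup_zero)
  moreover have "Poly_Mapping.lookup k i + Poly_Mapping.lookup l i = (if b = i then 1 else 0)"
    "Poly_Mapping.lookup k j + Poly_Mapping.lookup l j = (if b = j then 1 else 0)"
    using arg_cong[OF assms, of "\<lambda>m. Poly_Mapping.lookup m i"] arg_cong[OF assms, of "\<lambda>m. Poly_Mapping.lookup m j"]
    by (simp_all add: lookup_add lookup_single when_def)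
  ultimately show False by (auto split: if_splits)
qed

abbreviation low_coeff :: "nat \<Rightarrow> ((nat \<Rightarrow>\<^sub>0 nat) \<Rightarrow>\<^sub>0 'k::field) \<Rightarrow> 'k" where
  "low_coeff b p \<equiv> Poly_Mapping.lookup p (low_exponent b)"

lemma low_coeff_mult_0: "low_coeff 0 (p * q) = low_coeff 0 p * low_coeff 0 q"
  using subset_UNIV[of "Poly_Mapping.keys p"]
proof (induction rule: poly_mapping_induct)
  case (single u c)
  show ?case using subset_UNIV[of "Poly_Mapping.keys q"]
    by (induction rule: poly_mapping_induct)
      (auto simp: mult_single distrib_left lookup_add lookup_single when_def low_exponent_def add_eq_0_exponents)
qed (simp_all add: distrib_right lookup_add)

lemma low_coeff_mult:
  assumes b: "b \<noteq> 0"
  shows "low_coeff b (p * q) = low_coeff 0 p * low_coeff b q + low_coeff b p * low_coeff 0 q"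
  using subset_UNIV[of "Poly_Mapping.keys p"]
proof (induction rule: poly_mapping_induct)
  case (single u c)
  show ?case using subset_UNIV[of "Poly_Mapping.keys q"]
  proof (induction rule: poly_mapping_induct)
    case (single v d)
    have ne: "low_exponent b \<noteq> 0" "0 \<noteq> low_exponent b" using low_exponent_inj[of b 0] b by (auto simp: low_exponent_def)
    have "u = 0 \<or> v = 0" if "u + v = low_exponent b"
      using add_eq_single_exponents[of u v b] that b by (simp add: low_exponent_def)
    moreover have "low_exponent 0 = 0" by (simp add: low_exponent_def)
    ultimately show ?case using ne
      by (cases "u = 0"; cases "v = 0") (auto simp: mult_single lookup_single when_def)
  qed (simp_all add: distrib_left lookup_add algebra_simps)
qed (simp_all add: distrib_right lookup_add algebra_simps)

lemma exponents_split:
  assumes "u \<noteq> (0 :: nat \<Rightarrow>\<^sub>0 nat)"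
  obtains i v where "i \<in> Poly_Mapping.keys u" "u = Poly_Mapping.single i 1 + v"
    "Poly_Mapping.keys v \<subseteq> Poly_Mapping.keys u"
proof -
  obtain i where i: "i \<in> Poly_Mapping.keys u"
    using assms by (metis lookup_zero not_in_keys_iff_lookup_eq_zero poly_mapping_eqI)
  have "u = Poly_Mapping.single i 1 + (u - Poly_Mapping.single i 1)"
    using i by (intro poly_mapping_eqI) (auto simp: lookup_add lookup_minus lookup_single when_def in_keys_iff)
  moreover have "Poly_Mapping.keys (u - Poly_Mapping.single i 1) \<subseteq> Poly_Mapping.keys u"
    by (auto simp: in_keys_iff lookup_minus)
  ultimately show thesis using i that by blast
qed

text \<open>The parameter of type \<open>'k itself\<close> carries the field of coefficients, which \<open>n\<close> does not determine.\<close>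

locale truncated_polynomials =
  fixes n :: nat and dummy :: "'k::field itself"
  assumes n_pos: "0 < n"
begin

definition vars :: "nat set" where "vars = {1..n - 1}"

abbreviation P :: "('k, (nat \<Rightarrow>\<^sub>0 nat) \<Rightarrow>\<^sub>0 'k) module" where "P \<equiv> polynomial_algebra vars"

abbreviation max_ideal where "max_ideal \<equiv> Idl\<^bsub>P\<^esub> (variable ` vars)"

sublocale P: field_algebra P
  unfolding polynomial_algebra_eq by (rule monoid_algebra_is_algebra[OF comm_monoid_exponents])

lemma P_carrier: "carrier P = {p. Poly_Mapping.keys p \<subseteq> {m. Poly_Mapping.keys m \<subseteq> vars}}"
  by (auto simp: polynomial_algebra_def)

lemma P_simps: "monoid.mult P = (*)" "one P = 1" "zero P = 0" "add P = (+)"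
  "module.smult P = (\<lambda>c. Poly_Mapping.map ((*) c))"
  by (simp_all add: polynomial_algebra_def)

lemma variables_subset: "variable ` vars \<subseteq> carrier P"
  by (auto simp: P_carrier variable_def)

sublocale max_ideal: ideal max_ideal P
  by (rule P.genideal_ideal[OF variables_subset])

abbreviation max_ideal_sq where "max_ideal_sq \<equiv> max_ideal \<cdot>\<^bsub>P\<^esub> max_ideal"

sublocale max_ideal_sq: ideal max_ideal_sq P
  by (rule P.ideal_prod_is_ideal[OF max_ideal.is_ideal max_ideal.is_ideal])

sublocale algebra_quotient P max_ideal_sq ..

lemma R_alg_eq: "R_alg n = Q"
  by (simp add: R_alg_def Let_def vars_def)

lemma low_coeff_linear: "linear_functional P (low_coeff b)"
  by (simp add: linear_functional_def P_simps lookup_add)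

lemma low_coeff_0_max_ideal:
  assumes "p \<in> max_ideal"
  shows "low_coeff 0 p = 0"
proof (rule P.functional_vanishes_on_genideal[OF low_coeff_linear variables_subset _ assms])
  fix x y :: "(nat \<Rightarrow>\<^sub>0 nat) \<Rightarrow>\<^sub>0 'k" assume "x \<in> variable ` vars"
  then have "low_coeff 0 x = 0" by (auto simp: variable_def low_exponent_def lookup_single when_def poly_mapping_eq_iff fun_eq_iff)
  then show "low_coeff 0 (x \<otimes>\<^bsub>P\<^esub> y) = 0" by (simp add: P_simps low_coeff_mult_0)
qed

lemma low_coeff_max_ideal_sq: "p \<in> max_ideal_sq \<Longrightarrow> low_coeff b p = 0"
proof (induction rule: ideal_prod.induct)
  case (prod p q)
  then show ?case
    using low_coeff_0_max_ideal[of p] low_coeff_0_max_ideal[of q] by (cases "b = 0") (simp_all add: P_simps low_coeff_mult_0 low_coeff_mult)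
qed (simp add: P_simps lookup_add)

lemma single_in_max_ideal:
  assumes "Poly_Mapping.keys u \<subseteq> vars" "u \<noteq> 0"
  shows "Poly_Mapping.single u c \<in> max_ideal"
proof -
  obtain i v where iv: "i \<in> Poly_Mapping.keys u" "u = Poly_Mapping.single i 1 + v"
    "Poly_Mapping.keys v \<subseteq> Poly_Mapping.keys u"
    using exponents_split[OF assms(2)] by blast
  have "variable i \<in> max_ideal" using P.genideal_self[OF variables_subset] iv(1) assms(1) by blast
  moreover have "Poly_Mapping.single v c \<in> carrier P" using iv(3) assms(1) by (auto simp: P_carrier)
  ultimately have "variable i \<otimes>\<^bsub>P\<^esub> Poly_Mapping.single v c \<in> max_ideal" by (rule max_ideal.I_r_closed)
  then show ?thesis unfolding iv(2) by (simp add: P_simps variable_def mult_single)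
qed

lemma single_in_max_ideal_sq:
  assumes u: "Poly_Mapping.keys u \<subseteq> vars" and ne: "\<And>b. b < n \<Longrightarrow> u \<noteq> low_exponent b"
  shows "Poly_Mapping.single u c \<in> max_ideal_sq"
proof -
  have "u \<noteq> 0" using ne[of 0] n_pos by (simp add: low_exponent_def)
  then obtain i v where iv: "i \<in> Poly_Mapping.keys u" "u = Poly_Mapping.single i 1 + v"
    "Poly_Mapping.keys v \<subseteq> Poly_Mapping.keys u"
    using exponents_split by blast
  have i: "i \<in> vars" using iv(1) u by blast
  have "u \<noteq> low_exponent i" using i by (intro ne) (auto simp: vars_def)
  then have "v \<noteq> 0" using i iv(2) unfolding vars_def by (auto simp: low_exponent_def)
  then have "Poly_Mapping.single v c \<in> max_ideal" using iv(3) u by (intro single_in_max_ideal) auto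
  moreover have "variable i \<in> max_ideal" using P.genideal_self[OF variables_subset] i by blast
  ultimately have "variable i \<otimes>\<^bsub>P\<^esub> Poly_Mapping.single v c \<in> max_ideal_sq" by (intro ideal_prod.prod)
  then show ?thesis unfolding iv(2) by (simp add: P_simps variable_def mult_single)
qed

text \<open>Together with \<open>low_coeff_max_ideal_sq\<close> this describes the square of the ideal of the variables by the
vanishing of the coefficients of degree at most one. It holds because a monomial of degree at
least two is a product of two nonconstant monomials.\<close>

lemma max_ideal_sq_if_low_coeff_zero:
  assumes p: "p \<in> carrier P" and z: "\<And>b. b < n \<Longrightarrow> low_coeff b p = 0"
  shows "p \<in> max_ideal_sq"
proof -
  have sum: "(\<Sum>u\<in>U. Poly_Mapping.single u (g u)) \<in> max_ideal_sq"
    if "finite U" "\<And>u. u \<in> U \<Longrightarrow> Poly_Mapping.single u (g u) \<in> max_ideal_sq" for U g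
    using that
  proof (induction U rule: finite_induct)
    case empty
    show ?case using max_ideal_sq.zero_closed by (simp add: P_simps)
  next
    case (insert u U)
    then show ?case using max_ideal_sq.a_closed[of "Poly_Mapping.single u (g u)" "\<Sum>u\<in>U. Poly_Mapping.single u (g u)"]
      by (simp add: P_simps)
  qed
  have "(\<Sum>u\<in>Poly_Mapping.keys p. Poly_Mapping.single u (Poly_Mapping.lookup p u)) \<in> max_ideal_sq"
  proof (rule sum[OF finite_keys])
    fix u assume u: "u \<in> Poly_Mapping.keys p"
    show "Poly_Mapping.single u (Poly_Mapping.lookup p u) \<in> max_ideal_sq"
    proof (rule single_in_max_ideal_sq)
      show "Poly_Mapping.keys u \<subseteq> vars" using p u by (auto simp: P_carrier)
      show "u \<noteq> low_exponent b" if "b < n" for b using z[OF that] u by (auto simp: in_keys_iff)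
    qed
  qed
  then show ?thesis using poly_mapping_eq_sum_single[of p] by simp
qed

lemma single_low_exponent_in_P: "b < n \<Longrightarrow> Poly_Mapping.single (low_exponent b) c \<in> carrier P"
  unfolding P_carrier by (cases "b = 0") (auto simp: low_exponent_def vars_def)

lemma finsum_P: "finite S \<Longrightarrow> g ` S \<subseteq> carrier P \<Longrightarrow> (\<Oplus>\<^bsub>P\<^esub>i\<in>S. g i) = (\<Sum>i\<in>S. g i)"
proof (induction S rule: finite_induct)
  case (insert i S)
  then have "(\<Oplus>\<^bsub>P\<^esub>j\<in>Set.insert i S. g j) = g i \<oplus>\<^bsub>P\<^esub> (\<Oplus>\<^bsub>P\<^esub>j\<in>S. g j)"
    by (intro P.M.finsum_insert) auto
  then show ?case using insert by (simp add: P_simps)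
qed (simp add: P_simps)

abbreviation gen where "gen b \<equiv> proj (Poly_Mapping.single (low_exponent b) 1)"

lemma R_alg_square_zero_extension:
  obtains coord where "square_zero_extension (R_alg n :: ('k, ((nat \<Rightarrow>\<^sub>0 nat) \<Rightarrow>\<^sub>0 'k) set) module) n gen coord"
proof -
  have "\<exists>L'. linear_functional Q L' \<and> (\<forall>p\<in>carrier P. L' (proj p) = low_coeff b p)" for b
    using functional_descends[OF low_coeff_linear low_coeff_max_ideal_sq] by metis
  then obtain coord where lin: "\<And>b. linear_functional Q (coord b)"
    and coord: "\<And>b p. p \<in> carrier P \<Longrightarrow> coord b (proj p) = low_coeff b p" by metis
  interpret Q: field_algebra Q by (rule quotient_is_algebra)
  have gen_closed: "gen b \<in> carrier Q" if "b < n" for b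
    unfolding quotient_carrier using single_low_exponent_in_P[OF that] by blast
  have "square_zero_extension Q n gen coord"
  proof (unfold_locales)
    show "0 < n" by (rule n_pos)
    show "gen b \<in> carrier Q" if "b < n" for b by (rule gen_closed[OF that])
    show "linear_functional Q (coord b)" for b by (rule lin)
    show "coord b (gen b') = (if b = b' then 1 else 0)" if "b < n" "b' < n" for b b'
      using coord[OF single_low_exponent_in_P[OF that(2)]] by (simp add: lookup_single when_def low_exponent_inj)
  next
    fix a assume "a \<in> carrier Q"
    then obtain p where p: "p \<in> carrier P" and a: "a = proj p" unfolding quotient_carrier by blast
    define q where "q = (\<Sum>b<n. Poly_Mapping.single (low_exponent b) (low_coeff b p))"
    have q: "q = (\<Oplus>\<^bsub>P\<^esub>b\<in>{..<n}. Poly_Mapping.single (low_exponent b) (low_coeff b p))"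
      unfolding q_def using single_low_exponent_in_P by (intro finsum_P[symmetric]) auto
    have qP: "q \<in> carrier P" unfolding q using single_low_exponent_in_P by (intro P.M.finsum_closed) auto
    have pq: "p - q \<in> carrier P"
    proof -
      have "Poly_Mapping.keys (p - q) \<subseteq> Poly_Mapping.keys p \<union> Poly_Mapping.keys q"
        by (auto simp: in_keys_iff lookup_minus)
      then show ?thesis using p qP unfolding P_carrier by blast
    qed
    have "p - q \<in> max_ideal_sq"
    proof (rule max_ideal_sq_if_low_coeff_zero[OF pq])
      fix b assume b: "b < n"
      have "low_coeff b q = (\<Sum>b'<n. if b' = b then low_coeff b' p else 0)"
        unfolding q_def by (auto simp: lookup_sum lookup_single when_def low_exponent_inj intro!: sum.cong)
      also have "\<dots> = low_coeff b p" using b by simp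
      finally show "low_coeff b (p - q) = 0" by (simp add: lookup_minus)
    qed
    then have "proj (p - q) = \<zero>\<^bsub>Q\<^esub>" using quotient_zero_iff[OF pq] by blast
    moreover have "proj p = proj (p - q) \<oplus>\<^bsub>Q\<^esub> proj q"
      unfolding quotient_add[OF pq qP] by (simp add: P_simps)
    moreover have "proj q \<in> carrier Q" unfolding quotient_carrier using qP by blast
    ultimately have "a = proj q" unfolding a by simp
    also have "\<dots> = (\<Oplus>\<^bsub>Q\<^esub>b\<in>{..<n}. proj (Poly_Mapping.single (low_exponent b) (low_coeff b p)))"
      unfolding q using single_low_exponent_in_P by (intro quotient_finsum) auto
    also have "\<dots> = (\<Oplus>\<^bsub>Q\<^esub>b\<in>{..<n}. coord b a \<odot>\<^bsub>Q\<^esub> gen b)"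
    proof (rule Q.M.finsum_cong'[OF refl])
      show "(\<lambda>b. coord b a \<odot>\<^bsub>Q\<^esub> gen b) \<in> {..<n} \<rightarrow> carrier Q"
        using gen_closed by auto
      fix b assume "b \<in> {..<n}"
      then show "proj (Poly_Mapping.single (low_exponent b) (low_coeff b p)) = coord b a \<odot>\<^bsub>Q\<^esub> gen b"
        unfolding a coord[OF p] by (subst quotient_smult) (simp_all add: single_low_exponent_in_P P_simps map_times_single)
    qed
    finally show "a = (\<Oplus>\<^bsub>Q\<^esub>b\<in>{..<n}. coord b a \<odot>\<^bsub>Q\<^esub> gen b)" .
  next
    fix a y assume "a \<in> carrier Q" "y \<in> carrier Q"
    then obtain p q where p: "p \<in> carrier P" "a = proj p" and q: "q \<in> carrier P" "y = proj q"
      unfolding quotient_carrier by blast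
    have "coord b (a \<otimes>\<^bsub>Q\<^esub> y) = low_coeff b (p * q)" for b
      unfolding p(2) q(2) quotient_mult[OF p(1) q(1)] coord[OF P.m_closed[OF p(1) q(1)]]
      by (simp add: P_simps)
    moreover have "coord b a = low_coeff b p" "coord b y = low_coeff b q" for b
      unfolding p(2) q(2) using coord p(1) q(1) by auto
    ultimately show "coord 0 (a \<otimes>\<^bsub>Q\<^esub> y) = coord 0 a * coord 0 y"
      and "b \<noteq> 0 \<Longrightarrow> coord b (a \<otimes>\<^bsub>Q\<^esub> y) = coord 0 a * coord b y + coord b a * coord 0 y" for b
      by (simp_all add: low_coeff_mult_0 low_coeff_mult)
  qed
  then show thesis using that unfolding R_alg_eq by blast
qed

end

section \<open>Characteristic polynomials of multiplication maps\<close>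

context square_zero_extension
begin

sublocale V: vectorspace class_ring A by (rule is_vectorspace)

lemma coord_finsum:
  "finite S \<Longrightarrow> g ` S \<subseteq> carrier A \<Longrightarrow> coord b (\<Oplus>i\<in>S. g i) = (\<Sum>i\<in>S. coord b (g i))"
  by (rule linear_functional_finsum[OF is_module coord_linear])

lemma coord_smult: "a \<in> carrier A \<Longrightarrow> coord b (c \<odot> a) = c * coord b a"
  using coord_linear[of b] by (simp add: linear_functional_def)

lemma coord_add: "a \<in> carrier A \<Longrightarrow> a' \<in> carrier A \<Longrightarrow> coord b (a \<oplus> a') = coord b a + coord b a'"
  using coord_linear[of b] by (simp add: linear_functional_def)

lemma x_inj: "inj_on x {..<n}"
proof (rule inj_onI)
  fix b b' assume "b \<in> {..<n}" "b' \<in> {..<n}" "x b = x b'"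
  then show "b = b'" using coord_x[of b b] coord_x[of b b'] by (auto split: if_splits)
qed

lemma finsum_x: "(\<Oplus>v\<in>x ` {..<n}. g v \<odot> v) = (\<Oplus>b\<in>{..<n}. g (x b) \<odot> x b)"
  using x_closed by (intro M.finsum_reindex[OF _ x_inj]) auto

lemma x_basis: "V.basis (x ` {..<n})"
proof -
  have sub: "x ` {..<n} \<subseteq> carrier A" using x_closed by auto
  have "lin_indpt (x ` {..<n})"
  proof (rule finite_lin_indpt2[OF _ sub])
    fix g assume g: "lincomb g (x ` {..<n}) = \<zero>"
    have "g (x b) = 0" if b: "b < n" for b
    proof -
      have "0 = coord b (\<Oplus>b'\<in>{..<n}. g (x b') \<odot> x b')"
        using g linear_functional_zero[OF is_module coord_linear]
        by (simp add: lincomb_def finsum_x)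
      also have "\<dots> = (\<Sum>b'<n. g (x b') * coord b (x b'))"
        using x_closed by (subst coord_finsum) (auto intro!: sum.cong simp: coord_smult)
      also have "\<dots> = (\<Sum>b'<n. if b' = b then g (x b') else 0)"
        using b by (intro sum.cong) (auto simp: coord_x)
      finally show ?thesis using b by simp
    qed
    then show "\<forall>v\<in>x ` {..<n}. g v = \<zero>\<^bsub>class_ring\<^esub>" by auto
  qed simp
  moreover have "span (x ` {..<n}) = carrier A"
  proof
    show "span (x ` {..<n}) \<subseteq> carrier A" by (rule span_is_subset2[OF sub])
    show "carrier A \<subseteq> span (x ` {..<n})"
    proof
      fix a assume a: "a \<in> carrier A"
      define g where "g v = coord (the_inv_into {..<n} x v) a" for v
      have "lincomb g (x ` {..<n}) = (\<Oplus>b\<in>{..<n}. g (x b) \<odot> x b)"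
        unfolding lincomb_def by (rule finsum_x)
      also have "\<dots> = (\<Oplus>b\<in>{..<n}. coord b a \<odot> x b)"
        using x_closed by (intro M.finsum_cong') (auto simp: g_def the_inv_into_f_f[OF x_inj])
      also have "\<dots> = a" by (rule expansion[OF a, symmetric])
      finally have "a = lincomb g (x ` {..<n})" ..
      then show "a \<in> span (x ` {..<n})"
        unfolding finite_span[OF finite_imageI[OF finite_lessThan] sub]
        by (intro CollectI exI[of _ g] conjI) auto
    qed
  qed
  ultimately show ?thesis unfolding V.basis_def using sub by blast
qed

lemma fin_dim: "V.fin_dim"
  unfolding V.fin_dim_def
  by (rule exI[of _ "x ` {..<n}"]) (use x_basis in \<open>simp add: V.basis_def\<close>)

lemma dim_eq: "V.dim = n"
  using V.dim_basis[OF finite_imageI[OF finite_lessThan] x_basis] card_image[OF x_inj] by simp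

text \<open>The matrix of multiplication by \<open>a\<close> in the basis \<open>x\<close>: apart from the diagonal only column \<open>0\<close> is
occupied.\<close>

definition coord_matrix :: "'a \<Rightarrow> 'k mat" where
  "coord_matrix a = mat n n (\<lambda>(i, k). if i = k then coord 0 a else if k = 0 then coord i a else 0)"

lemma coord_mult_coord_matrix:
  assumes a: "a \<in> carrier A" and y: "y \<in> carrier A" and i: "i < n"
  shows "coord i (a \<otimes> y) = (\<Sum>k = 0..<n. coord_matrix a $$ (i, k) * coord k y)"
proof -
  have "(\<Sum>k = 0..<n. coord_matrix a $$ (i, k) * coord k y) =
      (\<Sum>k = 0..<n. (if k = i then coord 0 a * coord i y else 0) +
        (if k = 0 then (if i = 0 then 0 else coord i a * coord 0 y) else 0))"
    using i by (intro sum.cong) (auto simp: coord_matrix_def)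
  also have "\<dots> = coord 0 a * coord i y + (if i = 0 then 0 else coord i a * coord 0 y)"
    unfolding sum.distrib using i n_pos by simp
  also have "\<dots> = coord i (a \<otimes> y)"
    using coord_mult_0[OF a y] coord_mult[OF a y, of i] by (cases "i = 0") auto
  finally show ?thesis ..
qed

lemma char_poly_coord_matrix: "char_poly (coord_matrix a) = [:- coord 0 a, 1:] ^ n"
proof -
  have coord_matrix: "coord_matrix a \<in> carrier_mat n n" by (simp add: coord_matrix_def)
  have "char_poly (coord_matrix a) = char_poly (transpose_mat (coord_matrix a))" using coord_matrix by simp
  also have "\<dots> = (\<Prod>b \<leftarrow> diag_mat (transpose_mat (coord_matrix a)). [:- b, 1:])"
    by (rule char_poly_upper_triangular[of _ n]) (auto simp: coord_matrix_def upper_triangular_def)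
  also have "diag_mat (transpose_mat (coord_matrix a)) = replicate n (coord 0 a)"
    by (rule nth_equalityI) (auto simp: diag_mat_def coord_matrix_def)
  finally show ?thesis by (simp add: prod_list_replicate)
qed

text \<open>The matrix \<open>B\<close> of coordinates of the basis \<open>bs\<close> intertwines \<open>M\<close> with \<open>coord_matrix a\<close>. It is invertible
because \<open>bs\<close> spans and has length \<open>n\<close>, so the two matrices are similar.\<close>

lemma char_poly_mult_matrix:
  assumes a: "a \<in> carrier A" and d: "distinct bs" and bas: "V.basis (set bs)"
    and M: "mult_matrix A bs a M"
  shows "char_poly M = [:- coord 0 a, 1:] ^ n"
proof -
  have len: "length bs = n"
    using V.dim_basis[OF finite_set bas] dim_eq distinct_card[OF d] by simp
  have bsA: "set bs \<subseteq> carrier A" and gen: "span (set bs) = carrier A"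
    using bas unfolding V.basis_def by auto
  have nthA: "bs ! j \<in> carrier A" if "j < n" for j using bsA that len by auto
  have Mc: "M \<in> carrier_mat n n"
    and Mj: "\<And>j. j < n \<Longrightarrow> a \<otimes> bs ! j = (\<Oplus>i\<in>{..<n}. (M $$ (i, j)) \<odot> (bs ! i))"
    using M unfolding mult_matrix_def len by auto
  define B where "B = mat n n (\<lambda>(i, j). coord i (bs ! j))"
  have Bc: "B \<in> carrier_mat n n" by (simp add: B_def)
  have coord_matrix_carrier: "coord_matrix a \<in> carrier_mat n n" by (simp add: coord_matrix_def)
  have comm: "coord_matrix a * B = B * M"
  proof (rule eq_matI)
    fix k j assume "k < dim_row (B * M)" "j < dim_col (B * M)"
    then have k: "k < n" and j: "j < n" using Mc by (auto simp: B_def)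
    have "(coord_matrix a * B) $$ (k, j) = (\<Sum>l = 0..<n. coord_matrix a $$ (k, l) * coord l (bs ! j))"
      using k j coord_matrix_carrier by (simp add: scalar_prod_def B_def)
    also have "\<dots> = coord k (a \<otimes> bs ! j)" by (rule coord_mult_coord_matrix[OF a nthA[OF j] k, symmetric])
    also have "\<dots> = (\<Sum>i<n. M $$ (i, j) * coord k (bs ! i))"
      unfolding Mj[OF j] using nthA by (subst coord_finsum) (auto intro!: sum.cong simp: coord_smult)
    also have "\<dots> = (B * M) $$ (k, j)"
      using k j Mc by (simp add: scalar_prod_def B_def lessThan_atLeast0 mult.commute)
    finally show "(coord_matrix a * B) $$ (k, j) = (B * M) $$ (k, j)" .
  qed (use Mc in \<open>simp_all add: coord_matrix_def B_def\<close>)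
  have "\<exists>c. \<forall>k<n. x k = lincomb (c k) (set bs)"
  proof -
    have "\<exists>c. x k = lincomb c (set bs)" if "k < n" for k
    proof -
      have "x k \<in> span (set bs)" using x_closed[OF that] unfolding gen .
      then show ?thesis unfolding finite_span[OF finite_set bsA] by blast
    qed
    then show ?thesis by metis
  qed
  then obtain c where c: "\<And>k. k < n \<Longrightarrow> x k = lincomb (c k) (set bs)" by blast
  define C where "C = mat n n (\<lambda>(j, k). c k (bs ! j))"
  have Cc: "C \<in> carrier_mat n n" by (simp add: C_def)
  have BC: "B * C = 1\<^sub>m n"
  proof (rule eq_matI)
    fix i k assume "i < dim_row (1\<^sub>m n :: 'k mat)" "k < dim_col (1\<^sub>m n :: 'k mat)"
    then have i: "i < n" and k: "k < n" by auto
    have bij: "bij_betw (\<lambda>j. bs ! j) {0..<n} (set bs)"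
      using d len by (intro bij_betw_nth) auto
    have "(B * C) $$ (i, k) = (\<Sum>j = 0..<n. c k (bs ! j) * coord i (bs ! j))"
      using i k by (simp add: scalar_prod_def B_def C_def mult.commute)
    also have "\<dots> = (\<Sum>v\<in>set bs. c k v * coord i v)"
      by (rule sum.reindex_bij_betw[OF bij])
    also have "\<dots> = coord i (lincomb (c k) (set bs))"
      unfolding lincomb_def using bsA by (subst coord_finsum) (auto intro!: sum.cong simp: coord_smult subset_iff)
    also have "\<dots> = coord i (x k)" unfolding c[OF k] ..
    also have "\<dots> = 1\<^sub>m n $$ (i, k)" using i k by (simp add: coord_x)
    finally show "(B * C) $$ (i, k) = 1\<^sub>m n $$ (i, k)" .
  qed (simp_all add: B_def C_def)
  have CB: "C * B = 1\<^sub>m n" by (rule mat_mult_left_right_inverse[OF Bc Cc BC])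
  have "C * coord_matrix a * B = C * (B * M)" using comm assoc_mult_mat[OF Cc coord_matrix_carrier Bc] by simp
  also have "\<dots> = C * B * M" by (rule assoc_mult_mat[OF Cc Bc Mc, symmetric])
  also have "\<dots> = M" unfolding CB using Mc by simp
  finally have "similar_mat_wit M (coord_matrix a) C B"
    unfolding similar_mat_wit_def Let_def using Mc coord_matrix_carrier Bc Cc BC CB by auto
  then have "similar_mat M (coord_matrix a)" unfolding similar_mat_def by blast
  then show ?thesis using char_poly_similar char_poly_coord_matrix by metis
qed

lemma mult_matrix_x:
  assumes a: "a \<in> carrier A"
  shows "mult_matrix A (map x [0..<n]) a (coord_matrix a)"
  unfolding mult_matrix_def
proof (intro conjI allI impI)
  show "coord_matrix a \<in> carrier_mat (length (map x [0..<n])) (length (map x [0..<n]))" by (simp add: coord_matrix_def)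
next
  fix j assume "j < length (map x [0..<n])"
  then have j: "j < n" by simp
  have "a \<otimes> x j = (\<Oplus>i\<in>{..<n}. coord i (a \<otimes> x j) \<odot> x i)"
    using a x_closed[OF j] by (intro expansion) simp
  also have "\<dots> = (\<Oplus>i\<in>{..<n}. (coord_matrix a $$ (i, j)) \<odot> (map x [0..<n] ! i))"
  proof (rule M.finsum_cong'[OF refl])
    show "(\<lambda>i. (coord_matrix a $$ (i, j)) \<odot> (map x [0..<n] ! i)) \<in> {..<n} \<rightarrow> carrier A"
      using x_closed by auto
    fix i assume "i \<in> {..<n}"
    then have i: "i < n" by simp
    have "coord i (a \<otimes> x j) = (\<Sum>k = 0..<n. if k = j then coord_matrix a $$ (i, k) else 0)"
      unfolding coord_mult_coord_matrix[OF a x_closed[OF j] i] using j by (intro sum.cong) (auto simp: coord_x)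
    then show "coord i (a \<otimes> x j) \<odot> x i = (coord_matrix a $$ (i, j)) \<odot> (map x [0..<n] ! i)"
      using i j by simp
  qed
  finally show "a \<otimes> map x [0..<n] ! j = (\<Oplus>i\<in>{..<length (map x [0..<n])}. (coord_matrix a $$ (i, j)) \<odot> (map x [0..<n] ! i))"
    using j by simp
qed

lemma mult_char_poly_eq:
  assumes a: "a \<in> carrier A"
  shows "mult_char_poly A a = [:- coord 0 a, 1:] ^ n"
  unfolding mult_char_poly_def
proof (rule the_equality)
  have "distinct (map x [0..<n])" using x_inj by (simp add: distinct_map lessThan_atLeast0)
  moreover have "V.basis (set (map x [0..<n]))" using x_basis by (simp add: lessThan_atLeast0)
  ultimately show "\<exists>bs M. distinct bs \<and> V.basis (set bs) \<and> mult_matrix A bs a M \<and> [:- coord 0 a, 1:] ^ n = char_poly M"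
    using mult_matrix_x[OF a] char_poly_coord_matrix by metis
next
  fix p assume "\<exists>bs M. distinct bs \<and> V.basis (set bs) \<and> mult_matrix A bs a M \<and> p = char_poly M"
  then show "p = [:- coord 0 a, 1:] ^ n" using char_poly_mult_matrix[OF a] by blast
qed

text \<open>Reversing the coefficients of \<open>(x - a\<^sub>0)\<^sup>n\<close> turns it into \<open>(1 - a\<^sub>0 x)\<^sup>n\<close>, the polynomial by which column
determinants are multiplied.\<close>

lemma s_coeff_eq:
  assumes a: "a \<in> carrier A" and j: "j \<le> n"
  shows "s_coeff A j a = (- 1) ^ j * coeff ([:1, - coord 0 a:] ^ n) j"
proof -
  let ?p = "[:- coord 0 a, 1:]"
  have "[:1, - coord 0 a:] = reflect_poly ?p" by (auto simp: reflect_poly_def)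
  then have "coeff ([:1, - coord 0 a:] ^ n) j = coeff (reflect_poly (?p ^ n)) j"
    by (simp only: reflect_poly_power)
  also have "\<dots> = coeff (?p ^ n) (n - j)"
    using j by (simp add: coeff_reflect_poly degree_linear_power)
  finally show ?thesis
    by (simp add: s_coeff_def mult_char_poly_eq[OF a] dim_eq)
qed

section \<open>The dimension of the closure\<close>

sublocale tensor_power_of_algebra A n ..

text \<open>Tensor factors are numbered from \<open>1\<close>, positions in a word from \<open>0\<close>. The default \<open>0\<close> for positions
beyond the word keeps the product rules for coordinates valid at every position, where \<open>f\<close> need
not take values in the algebra.\<close>

definition word_functional :: "nat list \<Rightarrow> nat list \<Rightarrow> (nat \<Rightarrow> 'a) \<Rightarrow> 'k" where
  "word_functional cs w f = det (chain_matrix cs w (\<lambda>p b. if p < n then coord b (f (Suc p)) else 0))"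

lemma word_functional_multilinear:
  assumes len: "length w = n"
  shows "multilinear n A (word_functional cs w)"
  unfolding multilinear_def
proof (intro ballI conjI allI)
  fix f i a assume f: "f \<in> families n" and i: "i \<in> {1..n}" and a: "a \<in> carrier A"
  let ?u = "\<lambda>p b. if p < n then coord b (f (Suc p)) else 0"
  have upd: "word_functional cs w (f(i := z)) = det (chain_matrix cs w (?u(i - 1 := (\<lambda>b. coord b z))))" for z
    unfolding word_functional_def using i len by (intro det_chain_matrix_cong) auto
  have i': "i - 1 < length w" using i len by auto
  show "word_functional cs w (f(i := c \<odot> a)) = c * word_functional cs w (f(i := a))" for c
    unfolding upd by (simp only: coord_smult[OF a] det_chain_matrix_row_smult[OF i'])
  fix b assume b: "b \<in> carrier A"
  show "word_functional cs w (f(i := a \<oplus> b)) = word_functional cs w (f(i := a)) + word_functional cs w (f(i := b))"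
    unfolding upd by (simp only: coord_add[OF a b] det_chain_matrix_row_add[OF i'])
qed

text \<open>This is \<open>sum_det_chain_matrix_subsets\<close> in terms of tensor factors; the witnesses of the
reindexing shift positions by one.\<close>

lemma word_functional_symmetric:
  assumes ch: "chain_word cs w" and len: "length w = n"
    and a: "a \<in> carrier A" and j: "j \<in> {1..n}" and f: "f \<in> families n"
  shows "(\<Sum>S | S \<subseteq> {1..n} \<and> card S = j. word_functional cs w (\<lambda>i\<in>{1..n}. if i \<in> S then a \<otimes> f i else f i)) =
     s_coeff A j a * word_functional cs w f"
proof -
  let ?u = "\<lambda>p b. if p < n then coord b (f (Suc p)) else 0"
  let ?v = "\<lambda>p b. if p < n then coord b (a \<otimes> f (Suc p)) else 0"
  have fA: "f (Suc p) \<in> carrier A" if "p < n" for p using f that by auto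
  have "(\<Sum>S | S \<subseteq> {1..n} \<and> card S = j. word_functional cs w (\<lambda>i\<in>{1..n}. if i \<in> S then a \<otimes> f i else f i)) =
      (\<Sum>S | S \<subseteq> {0..<n} \<and> card S = j. det (chain_matrix cs w (\<lambda>p. if p \<in> S then ?v p else ?u p)))"
  proof (rule sum.reindex_bij_witness[of _ "image Suc" "image (\<lambda>i. i - 1)"])
    fix S assume S: "S \<in> {S. S \<subseteq> {1..n} \<and> card S = j}"
    then have pos: "1 \<le> i" "i \<le> n" if "i \<in> S" for i using that by auto
    then have *: "Suc (i - 1) = i" if "i \<in> S" for i using that by fastforce
    have "Suc ` (\<lambda>i. i - 1) ` S = (\<lambda>i. i) ` S"
      unfolding image_image using * by (intro image_cong) auto
    then show "Suc ` (\<lambda>i. i - 1) ` S = S" by simp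
    have "inj_on (\<lambda>i. i - 1) S"
    proof (rule inj_onI)
      fix p q assume "p \<in> S" "q \<in> S" "p - 1 = q - 1"
      then show "p = q" using *[of p] *[of q] by simp
    qed
    then have "card ((\<lambda>i. i - 1) ` S) = j" using S by (simp add: card_image)
    moreover have "i - 1 < n" if "i \<in> S" for i using pos[OF that] by simp
    ultimately show "(\<lambda>i. i - 1) ` S \<in> {S. S \<subseteq> {0..<n} \<and> card S = j}" by auto
    have mem: "p \<in> (\<lambda>i. i - 1) ` S \<longleftrightarrow> Suc p \<in> S" for p
    proof
      assume "p \<in> (\<lambda>i. i - 1) ` S"
      then obtain i where "i \<in> S" "p = i - 1" by blast
      then show "Suc p \<in> S" using *[of i] by simp
    next
      assume "Suc p \<in> S"
      then show "p \<in> (\<lambda>i. i - 1) ` S" by (rule rev_image_eqI) simp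
    qed
    show "det (chain_matrix cs w (\<lambda>p. if p \<in> (\<lambda>i. i - 1) ` S then ?v p else ?u p)) =
        word_functional cs w (\<lambda>i\<in>{1..n}. if i \<in> S then a \<otimes> f i else f i)"
      unfolding word_functional_def mem by (rule det_chain_matrix_cong) (use len in simp)
  next
    fix S assume S: "S \<in> {S. S \<subseteq> {0..<n} \<and> card S = j}"
    show "(\<lambda>i. i - 1) ` Suc ` S = S" by (simp add: image_image)
    show "Suc ` S \<in> {S. S \<subseteq> {1..n} \<and> card S = j}" using S by (auto simp: card_image)
  qed
  also have "\<dots> = (- 1) ^ j * coeff ([:1, - coord 0 a:] ^ length w) j * det (chain_matrix cs w ?u)"
    unfolding len[symmetric]
  proof (rule sum_det_chain_matrix_subsets[OF ch, where \<alpha> = "\<lambda>b. coord b a"])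
    show "(if p < length w then coord 0 (a \<otimes> f (Suc p)) else 0) =
        coord 0 a * (if p < length w then coord 0 (f (Suc p)) else 0)" for p
      using fA a len by (simp add: coord_mult_0)
    show "(if p < length w then coord b (a \<otimes> f (Suc p)) else 0) =
        coord 0 a * (if p < length w then coord b (f (Suc p)) else 0) +
        coord b a * (if p < length w then coord 0 (f (Suc p)) else 0)" if "b \<noteq> 0" for p b
      using fA a len that by (simp add: coord_mult)
  qed
  also have "\<dots> = s_coeff A j a * word_functional cs w f"
    using s_coeff_eq[OF a, of j] j len by (simp add: word_functional_def)
  finally show ?thesis .
qed

definition word_family :: "nat list \<Rightarrow> nat \<Rightarrow> 'a" where
  "word_family w = (\<lambda>i\<in>{1..n}. x (w ! (i - 1)))"

lemma word_family_closed:
  assumes "length w = n" "set w \<subseteq> {..<n}"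
  shows "word_family w \<in> families n"
proof -
  have "x (w ! (i - 1)) \<in> carrier A" if "i \<in> {1..n}" for i
  proof (rule x_closed)
    have "w ! (i - 1) \<in> set w" using that assms by (intro nth_mem) auto
    then show "w ! (i - 1) < n" using assms by auto
  qed
  then show ?thesis by (auto simp: word_family_def)
qed

lemma word_functional_word:
  assumes w: "length w = n" "set w \<subseteq> {..<n}" and w': "length w' = n" "set w' \<subseteq> {..<n}"
  shows "word_functional cs w (word_family w') = det (chain_matrix cs w (\<lambda>p b. if b = w' ! p then 1 else 0))"
  unfolding word_functional_def
proof (rule det_chain_matrix_cong)
  fix p q assume p: "p < length w" and q: "q < length w"
  have "w ! q < n" "w' ! p < n"
    using subsetD[OF w(2) nth_mem[OF q]] subsetD[OF w'(2) nth_mem[of p w']] p w(1) w'(1) by simp_all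
  then show "(if p < n then coord (w ! q) (word_family w' (Suc p)) else 0) = (if w ! q = w' ! p then 1 else 0)"
    using p w by (simp add: word_family_def coord_x)
qed

lemma fact_less_dim_Sn_closure:
  assumes n: "3 < n"
  shows "vectorspace.fin_dim class_ring (Sn_closure A) \<and> fact n < vectorspace.dim class_ring (Sn_closure A)"
proof -
  let ?I = "closure_ideal A"
  let ?R = "{(s_coeff A j a \<odot>\<^bsub>T\<^esub> \<one>\<^bsub>T\<^esub>) \<ominus>\<^bsub>T\<^esub> elementary j a | a j. a \<in> carrier A \<and> j \<in> {1..n}}"
  have I: "?I = Idl\<^bsub>T\<^esub> ?R" by (simp only: closure_ideal_def Let_def dim_eq)
  have RT: "?R \<subseteq> carrier T"
    using elementary_closed T.smult_closed[of _ "\<one>\<^bsub>T\<^esub>"] by (auto intro!: T.minus_closed)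
  have ideal: "ideal ?I T" unfolding I by (rule T.genideal_ideal[OF RT])
  interpret I: ideal ?I T by (rule ideal)
  interpret TI: algebra_quotient T ?I ..
  have G: "Sn_closure A = TI.Q" by (simp add: Sn_closure_def dim_eq)
  interpret G: field_algebra TI.Q by (rule TI.quotient_is_algebra)
  have fd: "vectorspace.fin_dim class_ring TI.Q"
    by (rule T.fin_dim_quotient[OF fin_dim_tensor_power[OF fin_dim] ideal])
  have "\<exists>L. linear_functional TI.Q L \<and>
      (\<forall>w'. length w' = n \<and> set w' \<subseteq> {..<n} \<longrightarrow>
        (L (TI.proj (pt (word_family w'))) \<noteq> 0 \<longrightarrow> w' \<le> w) \<and> (w' = w \<longrightarrow> L (TI.proj (pt (word_family w'))) = 1))"
    if wc: "w \<in> chain_words n" for w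
  proof -
    obtain cs where ch: "chain_word cs w" and w: "length w = n" "set w \<subseteq> {..<n}"
      using wc unfolding chain_words_def by blast
    obtain L where L: "linear_functional T L" "\<And>f. f \<in> families n \<Longrightarrow> L (pt f) = word_functional cs w f"
      using functional_on_tensor_power[OF word_functional_multilinear[OF w(1)]] by blast
    have "L X = 0" if "X \<in> ?I" for X
      using functional_vanishes_on_closure_relations[OF L word_functional_symmetric[OF ch w(1)] that[unfolded I]] .
    then obtain L' where L': "linear_functional TI.Q L'" "\<And>X. X \<in> carrier T \<Longrightarrow> L' (TI.proj X) = L X"
      using TI.functional_descends[OF L(1)] by blast
    have val: "L' (TI.proj (pt (word_family w'))) = det (chain_matrix cs w (\<lambda>p b. if b = w' ! p then 1 else 0))"
      if "length w' = n" "set w' \<subseteq> {..<n}" for w'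
      using L'(2)[OF pt_closed] L(2) word_family_closed[OF that] word_functional_word[OF w that] by simp
    show ?thesis
    proof (intro exI[of _ L'] conjI allI impI)
      show "linear_functional TI.Q L'" by (rule L'(1))
      fix w' assume w': "length w' = n \<and> set w' \<subseteq> {..<n}"
      then have val': "L' (TI.proj (pt (word_family w'))) = det (chain_matrix cs w (\<lambda>p b. if b = w' ! p then 1 else 0))"
        by (intro val) auto
      show "w' \<le> w" if "L' (TI.proj (pt (word_family w'))) \<noteq> 0"
        using that det_chain_matrix_lex[OF ch] w w' unfolding val' by metis
      show "L' (TI.proj (pt (word_family w'))) = 1" if "w' = w"
        using val' unfolding that det_chain_matrix_self[OF ch] .
    qed
  qed
  then obtain L where L: "\<And>w. w \<in> chain_words n \<Longrightarrow> linear_functional TI.Q (L w)"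
    and tri: "\<And>w w'. w \<in> chain_words n \<Longrightarrow> length w' = n \<Longrightarrow> set w' \<subseteq> {..<n} \<Longrightarrow>
      L w (TI.proj (pt (word_family w'))) \<noteq> 0 \<Longrightarrow> w' \<le> w"
    and one: "\<And>w. w \<in> chain_words n \<Longrightarrow> length w = n \<Longrightarrow> set w \<subseteq> {..<n} \<Longrightarrow>
      L w (TI.proj (pt (word_family w))) = 1"
    by metis
  have word: "length w = n" "set w \<subseteq> {..<n}" if "w \<in> chain_words n" for w
    using that by (auto simp: chain_words_def)
  have "card (chain_words n) \<le> vectorspace.dim class_ring TI.Q"
  proof (rule card_le_dim_if_triangular[OF G.is_vectorspace fd finite_chain_words])
    fix w assume w: "w \<in> chain_words n"
    show "TI.proj (pt (word_family w)) \<in> carrier TI.Q"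
      unfolding TI.quotient_carrier by (rule imageI[OF pt_closed[OF word_family_closed[OF word[OF w]]]])
    show "linear_functional TI.Q (L w)" by (rule L[OF w])
    show "L w (TI.proj (pt (word_family w))) = 1" by (rule one[OF w word[OF w]])
    fix w' assume "w' \<in> chain_words n" "L w (TI.proj (pt (word_family w'))) \<noteq> 0"
    then show "w' \<le> w" using tri[OF w] word by blast
  qed
  then show ?thesis unfolding G using fd card_chain_words[OF n] by simp
qed

end

theorem theorem9:
  fixes n :: nat
  assumes "CHAR('k::field) = 0 \<or> coprime CHAR('k) (fact n)"
    and "n > 3"
  shows "let G = Sn_closure (R_alg n :: ('k, ((nat \<Rightarrow>\<^sub>0 nat) \<Rightarrow>\<^sub>0 'k) set) module)
         in vectorspace.fin_dim class_ring G \<and> vectorspace.dim class_ring G > fact n"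
proof -
  interpret truncated_polynomials n "TYPE('k)"
    by unfold_locales (use assms(2) in simp)
  obtain coord where "square_zero_extension (R_alg n :: ('k, ((nat \<Rightarrow>\<^sub>0 nat) \<Rightarrow>\<^sub>0 'k) set) module) n gen coord"
    by (rule R_alg_square_zero_extension)
  from square_zero_extension.fact_less_dim_Sn_closure[OF this assms(2)] show ?thesis
    unfolding Let_def .
qed

end
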